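(* Suppose that $n \geq 2^{19}$ and $t$ is an integer with $1 < t \leq \frac{n}{4032 \log_2 n}$. Let $\mathcal{F}$ be a $t$-intersecting family of spanning trees of $K_n$ (trees on the labelled vertex set $[n]$). Then \[ |\mathcal{F}| \leq 2^t n^{n-t-2}. \] Moreover, equality holds if and only if $\mathcal{F}$ consists of all spanning trees of $K_n$ containing a fixed set of $t$ pairwise disjoint edges.
   Context: $K_n$ is the complete graph on vertex set $[n]=\{1,\dots,n\}$. A spanning tree is identified with its edge set, a subset of $\binom{[n]}{2}$ of size $n-1$. Two spanning trees are $t$-intersecting if they share at least $t$ edges; a family of spanning trees is $t$-intersecting if every two of its members are $t$-intersecting. *)

theory Defs
  imports Complex_Main
begin

text \<open>Edges of the complete graph K_n on vertex set [n] = {1..n}: 2-element subsets.\<close>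
definition Kn_edges :: "nat \<Rightarrow> nat set set" where
  "Kn_edges n = {e. e \<subseteq> {1..n} \<and> card e = 2}"

text \<open>Adjacency relation of the graph with edge set E.\<close>
definition adj :: "nat set set \<Rightarrow> (nat \<times> nat) set" where
  "adj E = {(u, v). {u, v} \<in> E \<and> u \<noteq> v}"

text \<open>E connects all of V: any two vertices of V are joined by a path in E.\<close>
definition connected_on :: "nat set \<Rightarrow> nat set set \<Rightarrow> bool" where
  "connected_on V E \<longleftrightarrow> (\<forall>u\<in>V. \<forall>v\<in>V. (u, v) \<in> (adj E)\<^sup>*)"

text \<open>Acyclic (a forest): no edge lies on a cycle, i.e. removing any edge
  disconnects its endpoints.\<close>
definition acyclic_graph :: "nat set set \<Rightarrow> bool" where
  "acyclic_graph E \<longleftrightarrow> (\<forall>u v. {u, v} \<in> E \<longrightarrow> u \<noteq> v \<longrightarrow> (u, v) \<notin> (adj (E - {{u, v}}))\<^sup>*)"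

text \<open>Spanning trees of K_n, identified with their edge sets.\<close>
definition spanning_tree :: "nat \<Rightarrow> nat set set \<Rightarrow> bool" where
  "spanning_tree n T \<longleftrightarrow> T \<subseteq> Kn_edges n \<and> connected_on {1..n} T \<and> acyclic_graph T"

definition t_intersecting :: "nat \<Rightarrow> nat set set set \<Rightarrow> bool" where
  "t_intersecting t F \<longleftrightarrow> (\<forall>T1\<in>F. \<forall>T2\<in>F. card (T1 \<inter> T2) \<ge> t)"

end

theory Submission
  imports Defs
begin

text \<open>A forest with k edges and component sizes c_i lies in (prod c_i) n^(n-2-k) spanning trees. As
  prod c_i \<le> 2^k, with equality exactly for matchings, the spanning trees form an (n/2)-spread
  family. Removing greedily the sets S of maximal relative degree covers all but a negligible
  part of F by stars over sets S of size O(t log n) whose links are (n/4)-spread. Two spread families have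
  disjoint members: a random half of the edges contains, with probability above 1/2, a member of
  either one, by three fragmentation rounds that shrink the members and a second moment argument.
  So the sets S pairwise share t elements. Passing to minimal generating sets and peeling off the
  largest ones shows that the S either cover few trees or all contain a common t-set T. In the latter case, if T is
  a matching, a tree of F not containing T rules out a polynomially small but, compared with the
  uncovered part, large proportion of the trees containing T.\<close>

section \<open>Random subsets and spread families\<close>

text \<open>The spreadness n/4 of the links is of the same order as the size n - 1 of the trees, and
  the constants turn on this ratio. A second moment bound 1 - m / (p R) says nothing for m near 4 R,
  but three rounds, each dividing the size by 4 at a cost of 1/16, bring m down to R / 16, where
  fixed densities suffice. The bound n >= 2^19 amounts to R = n/4 >= 2^17, the spreadness that a
  round asks for. The logarithm in the bound on t comes from the approximation. The trees are
  (n/2)-spread and the links only need to be (n/4)-spread, so a maximal S with more than q elements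
  leaves at most a 2^(-q-1) share of all n^(n-2) trees. This has to be below n^(-t-7), hence q is
  about (t + 7) log_2 n; the exponent 7 pays for a factor 2 n^6 lost when counting the trees ruled
  out. As t >= 2, this is at most 9/2 t log_2 n, and 4032 = 896 * 9/2 yields 896 q <= n, so q is a
  small fraction of the spreadness. The equality case shapes the end: every case other than a full
  star over a matching must give a strict inequality.\<close>

definition expect :: "real \<Rightarrow> 'a set \<Rightarrow> ('a set \<Rightarrow> real) \<Rightarrow> real" where
  "expect p \<Omega> f = (\<Sum>W\<in>Pow \<Omega>. p ^ card W * (1 - p) ^ card (\<Omega> - W) * f W)"

lemma expect_cong: "(\<And>W. W \<subseteq> \<Omega> \<Longrightarrow> f W = g W) \<Longrightarrow> expect p \<Omega> f = expect p \<Omega> g"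
  unfolding expect_def by (intro sum.cong) auto

lemma expect_empty [simp]: "expect p {} f = f {}"
  by (simp add: expect_def)

text \<open>Conditions on whether x is chosen: \<open>expect p \<Omega>\<close> averages over a
  random subset containing each point independently with probability p. This recursion drives the
  inductions on \<Omega>.\<close>

lemma expect_insert:
  assumes "finite \<Omega>" "x \<notin> \<Omega>"
  shows "expect p (insert x \<Omega>) f = (1 - p) * expect p \<Omega> f + p * expect p \<Omega> (\<lambda>W. f (insert x W))"
proof -
  let ?w = "\<lambda>W. p ^ card W * (1 - p) ^ card (insert x \<Omega> - W) * f W"
  have inj: "inj_on (insert x) (Pow \<Omega>)"
    using assms(2) by (auto simp: inj_on_def) 
  have "expect p (insert x \<Omega>) f = sum ?w (Pow \<Omega>) + sum ?w (insert x ` Pow \<Omega>)"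
    unfolding expect_def Pow_insert using assms by (intro sum.union_disjoint) auto
  also have "sum ?w (insert x ` Pow \<Omega>) = (\<Sum>W\<in>Pow \<Omega>. ?w (insert x W))"
    using inj by (simp add: sum.reindex)
  also have "\<dots> = p * expect p \<Omega> (\<lambda>W. f (insert x W))"
    unfolding expect_def sum_distrib_left
  proof (intro sum.cong refl)
    fix W assume "W \<in> Pow \<Omega>"
    then have "finite W" "x \<notin> W" using assms finite_subset by auto
    moreover have "insert x \<Omega> - insert x W = \<Omega> - W" using assms(2) by auto
    ultimately show "?w (insert x W) = p * (p ^ card W * (1 - p) ^ card (\<Omega> - W) * f (insert x W))"
      by simp
  qed
  also have "sum ?w (Pow \<Omega>) = (1 - p) * expect p \<Omega> f"
    unfolding expect_def sum_distrib_left
  proof (intro sum.cong refl)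
    fix W assume "W \<in> Pow \<Omega>"
    then have "insert x \<Omega> - W = insert x (\<Omega> - W)" "x \<notin> \<Omega> - W" using assms(2) by auto
    then show "?w W = (1 - p) * (p ^ card W * (1 - p) ^ card (\<Omega> - W) * f W)"
      using assms(1) by simp
  qed
  finally show ?thesis .
qed

lemma expect_add: "expect p \<Omega> (\<lambda>W. f W + g W) = expect p \<Omega> f + expect p \<Omega> g"
  by (simp add: expect_def algebra_simps sum.distrib)

lemma expect_diff: "expect p \<Omega> (\<lambda>W. f W - g W) = expect p \<Omega> f - expect p \<Omega> g"
  by (simp add: expect_def algebra_simps sum_subtractf)

lemma expect_cmult: "expect p \<Omega> (\<lambda>W. c * f W) = c * expect p \<Omega> f"
  by (simp add: expect_def sum_distrib_left mult_ac)

lemma expect_sum: "expect p \<Omega> (\<lambda>W. \<Sum>i\<in>I. f i W) = (\<Sum>i\<in>I. expect p \<Omega> (f i))"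
  unfolding expect_def by (simp add: sum_distrib_left) (rule sum.swap)

lemma expect_mono:
  assumes "0 \<le> p" "p \<le> 1" "\<And>W. W \<subseteq> \<Omega> \<Longrightarrow> f W \<le> g W"
  shows "expect p \<Omega> f \<le> expect p \<Omega> g"
  unfolding expect_def using assms by (intro sum_mono mult_left_mono) auto

lemma expect_const [simp]: "finite \<Omega> \<Longrightarrow> expect p \<Omega> (\<lambda>_. c) = c"
  by (induction \<Omega> rule: finite_induct) (auto simp: expect_insert algebra_simps)

text \<open>Two independent random sets both miss a point with probability (1 - p) (1 - p'), so
  their union is again a random set. This lets the density be spent in separate rounds.\<close>

lemma expect_Un:
  assumes "finite \<Omega>"
  shows "expect p \<Omega> (\<lambda>U. expect p' \<Omega> (\<lambda>V. f (U \<union> V))) = expect (p + p' - p * p') \<Omega> f"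
  using assms
proof (induction \<Omega> arbitrary: f rule: finite_induct)
  case (insert x \<Omega>)
  have "expect p (insert x \<Omega>) (\<lambda>U. expect p' (insert x \<Omega>) (\<lambda>V. f (U \<union> V))) =
      (1 - p) * (1 - p') * expect p \<Omega> (\<lambda>U. expect p' \<Omega> (\<lambda>V. f (U \<union> V)))
      + (p + p' - p * p') * expect p \<Omega> (\<lambda>U. expect p' \<Omega> (\<lambda>V. f (insert x (U \<union> V))))"
    using insert.hyps by (simp add: expect_insert expect_add expect_cmult) (simp add: algebra_simps)
  also have "\<dots> = expect (p + p' - p * p') (insert x \<Omega>) f"
    unfolding insert.IH insert.IH[of "\<lambda>W. f (insert x W)"]
    using insert.hyps by (simp add: expect_insert algebra_simps)
  finally show ?case .
qed auto

lemma expect_compl: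
  assumes "finite \<Omega>"
  shows "expect p \<Omega> (\<lambda>W. f (\<Omega> - W)) = expect (1 - p) \<Omega> f"
proof -
  have "bij_betw (\<lambda>W. \<Omega> - W) (Pow \<Omega>) (Pow \<Omega>)"
    by (rule bij_betw_byWitness[where f' = "\<lambda>W. \<Omega> - W"]) auto
  then have "expect (1 - p) \<Omega> f
      = (\<Sum>W\<in>Pow \<Omega>. (1 - p) ^ card (\<Omega> - W) * (1 - (1 - p)) ^ card (\<Omega> - (\<Omega> - W)) * f (\<Omega> - W))"
    unfolding expect_def by (rule sum.reindex_bij_betw[symmetric])
  also have "\<dots> = expect p \<Omega> (\<lambda>W. f (\<Omega> - W))"
    unfolding expect_def by (intro sum.cong) (auto simp: double_diff)
  finally show ?thesis by simp
qed

lemma expect_member: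
  assumes "finite \<Omega>" "x \<in> \<Omega>"
  shows "expect p \<Omega> (\<lambda>W. of_bool (x \<in> W) * f W) = p * expect p \<Omega> (\<lambda>W. f (insert x W))"
proof -
  define \<Omega>' where "\<Omega>' = \<Omega> - {x}"
  have *: "\<Omega> = insert x \<Omega>'" "x \<notin> \<Omega>'" "finite \<Omega>'" using assms by (auto simp: \<Omega>'_def)
  have "expect p \<Omega>' (\<lambda>W. of_bool (x \<in> W) * f W) = expect p \<Omega>' (\<lambda>_. 0)"
    using *(2) by (intro expect_cong) auto
  then show ?thesis
    using *(2,3) by (simp add: *(1) expect_insert algebra_simps)
qed

text \<open>Given A \<subseteq> W, the points outside A are still independent, so W is distributed
  like W \<union> A. Read from right to left, a set A added by force is traded for a factor 1 / p ^
  card A.\<close>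

lemma expect_superset:
  assumes "finite \<Omega>" "A \<subseteq> \<Omega>"
  shows "expect p \<Omega> (\<lambda>W. of_bool (A \<subseteq> W) * f W) = p ^ card A * expect p \<Omega> (\<lambda>W. f (W \<union> A))"
proof -
  have "finite A" using assms finite_subset by auto
  then show ?thesis using assms(2)
  proof (induction A arbitrary: f rule: finite_induct)
    case (insert a A)
    have "expect p \<Omega> (\<lambda>W. of_bool (insert a A \<subseteq> W) * f W)
        = expect p \<Omega> (\<lambda>W. of_bool (a \<in> W) * (of_bool (A \<subseteq> W) * f W))"
      by (intro expect_cong) auto
    also have "\<dots> = p * expect p \<Omega> (\<lambda>W. of_bool (A \<subseteq> insert a W) * f (insert a W))"
      using insert.prems assms(1) by (subst expect_member) auto
    also have "\<dots> = p * expect p \<Omega> (\<lambda>W. of_bool (A \<subseteq> W) * f (insert a W))"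
      using insert.hyps(2) by (simp add: subset_insert)
    also have "\<dots> = p * (p ^ card A * expect p \<Omega> (\<lambda>W. f (insert a (W \<union> A))))"
      using insert by simp
    finally show ?case using insert.hyps by simp
  qed simp
qed

lemma expect_prob_superset:
  assumes "finite \<Omega>" "A \<subseteq> \<Omega>"
  shows "expect p \<Omega> (\<lambda>W. of_bool (A \<subseteq> W)) = p ^ card A"
  using expect_superset[OF assms, of p "\<lambda>_. 1"] assms(1) by simp

section \<open>Spread families: fragmentation and the second moment\<close>

lemma sum_Pow_power:
  fixes y :: real
  assumes "finite C"
  shows "(\<Sum>X\<in>Pow C. y ^ card X) = (1 + y) ^ card C"
  using assms
proof (induction C rule: finite_induct)
  case (insert x C)
  have inj: "inj_on (insert x) (Pow C)"
    using insert.hyps by (auto simp: inj_on_def)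
  have "(\<Sum>X\<in>Pow (insert x C). y ^ card X)
      = (\<Sum>X\<in>Pow C. y ^ card X) + (\<Sum>X\<in>insert x ` Pow C. y ^ card X)"
    unfolding Pow_insert using insert.hyps by (intro sum.union_disjoint) auto
  also have "(\<Sum>X\<in>insert x ` Pow C. y ^ card X) = (\<Sum>X\<in>Pow C. y * y ^ card X)"
    unfolding sum.reindex[OF inj] o_def
  proof (intro sum.cong refl)
    fix X assume "X \<in> Pow C"
    then have "finite X" "x \<notin> X" using insert.hyps finite_subset by auto
    then show "y ^ card (insert x X) = y * y ^ card X" by simp
  qed
  finally show ?case
    using insert by (simp add: sum_distrib_left[symmetric] algebra_simps)
qed simp

text \<open>Members carry indices because distinct members may shrink to equal fragments and must
  still be counted separately. The normaliser M is free rather than \<open>card I\<close>, so that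
  it stays fixed while indices are discarded and members shrink.\<close>

definition spread_family ::
    "'a set \<Rightarrow> real \<Rightarrow> real \<Rightarrow> nat \<Rightarrow> 'i set \<Rightarrow> ('i \<Rightarrow> 'a set) \<Rightarrow> bool" where
  "spread_family \<Omega> R M k I A \<longleftrightarrow> finite I \<and> (\<forall>i\<in>I. A i \<subseteq> \<Omega> \<and> card (A i) \<le> k) \<and>
     (\<forall>X\<subseteq>\<Omega>. real (card {i\<in>I. X \<subseteq> A i}) * R ^ card X \<le> M)"

lemma spread_familyD:
  assumes "spread_family \<Omega> R M k I A"
  shows "finite I" "\<And>i. i \<in> I \<Longrightarrow> A i \<subseteq> \<Omega>" "\<And>i. i \<in> I \<Longrightarrow> card (A i) \<le> k"
    "\<And>X. X \<subseteq> \<Omega> \<Longrightarrow> real (card {i\<in>I. X \<subseteq> A i}) * R ^ card X \<le> M"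
  using assms by (auto simp: spread_family_def)

lemma card_Collect_eq_sum_of_bool:
  "finite I \<Longrightarrow> real (card {i\<in>I. P i}) = (\<Sum>i\<in>I. of_bool (P i))"
  by (simp add: Collect_conj_eq Int_commute)

text \<open>Union bound over the m-subsets of B, one of which lies in any A i that meets B in m
  points.\<close>

lemma spread_family_large_intersection:
  assumes S: "spread_family \<Omega> R M k I A" and "finite \<Omega>" "R > 0" "B \<subseteq> \<Omega>" "card B \<le> k"
  shows "real (card {i\<in>I. m \<le> card (A i \<inter> B)}) \<le> real (k choose m) * M / R ^ m"
proof -
  note S = spread_familyD[OF S]
  have finB: "finite B" using assms finite_subset by auto
  have M0: "0 \<le> M" using S(4)[of "{}"] by simp
  let ?P = "{X. X \<subseteq> B \<and> card X = m}"
  have finP: "finite ?P" using finB by simp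
  have "{i\<in>I. m \<le> card (A i \<inter> B)} \<subseteq> (\<Union>X\<in>?P. {i\<in>I. X \<subseteq> A i})"
  proof
    fix i assume i: "i \<in> {i\<in>I. m \<le> card (A i \<inter> B)}"
    then obtain X where "X \<subseteq> A i \<inter> B" "card X = m"
        using obtain_subset_with_card_n[of m "A i \<inter> B"] by blast
    then show "i \<in> (\<Union>X\<in>?P. {i\<in>I. X \<subseteq> A i})" using i by auto
  qed
  then have "card {i\<in>I. m \<le> card (A i \<inter> B)} \<le> card (\<Union>X\<in>?P. {i\<in>I. X \<subseteq> A i})"
    using finP S(1) by (intro card_mono) auto
  also have "\<dots> \<le> (\<Sum>X\<in>?P. card {i\<in>I. X \<subseteq> A i})"
    by (rule card_UN_le[OF finP])
  finally have "real (card {i\<in>I. m \<le> card (A i \<inter> B)}) \<le> (\<Sum>X\<in>?P. real (card {i\<in>I. X \<subseteq> A i}))"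
    by (simp flip: of_nat_sum)
  also have "\<dots> \<le> (\<Sum>X\<in>?P. M / R ^ m)"
  proof (intro sum_mono)
    fix X assume "X \<in> ?P"
    then show "real (card {i\<in>I. X \<subseteq> A i}) \<le> M / R ^ m"
      using S(4)[of X] assms by (auto simp: field_simps)
  qed
  also have "\<dots> = real (card B choose m) * (M / R ^ m)"
    using n_subsets[OF finB, of m] by simp
  also have "\<dots> \<le> real (k choose m) * (M / R ^ m)"
    using assms M0 by (intro mult_right_mono) (auto simp: binomial_right_mono)
  finally show ?thesis by simp
qed

text \<open>The fragment of i is the smallest part outside W of a member inside A i \<union> W. Put
  Z = W \<union> A i and pick a member inside Z by a rule that sees only Z. Outside W this member
  lies in A i, so a fragment of size at least m forces A i to meet it in at least m points. For
  fixed Z it is one fixed set, and spreadness leaves few such i. Passing from W to Z costs the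
  factor 1 / p ^ k.\<close>

lemma fragmentation:
  fixes A :: "'i \<Rightarrow> 'a set"
  assumes S: "spread_family \<Omega> R M k I A" and fin: "finite \<Omega>" and p: "0 < p" "p \<le> 1" and R: "R > 0"
  obtains \<chi> where "\<And>i W. i \<in> I \<Longrightarrow> \<chi> i W \<subseteq> A i"
    and "\<And>i W. i \<in> I \<Longrightarrow> \<exists>j\<in>I. A j \<subseteq> W \<union> \<chi> i W"
    and "expect p \<Omega> (\<lambda>W. real (card {i\<in>I. m \<le> card (\<chi> i W)})) \<le> real (k choose m) * M / (p ^ k * R ^ m)"
proof -
  note S' = spread_familyD[OF S]
  have M0: "0 \<le> M" using S'(4)[of "{}"] by simp
  define J where "J i W = arg_min (\<lambda>j. card (A j - W)) (\<lambda>j. j \<in> I \<and> A j \<subseteq> A i \<union> W)" for i W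
  have J: "J i W \<in> I" "A (J i W) \<subseteq> A i \<union> W"
      "\<And>j. j \<in> I \<Longrightarrow> A j \<subseteq> A i \<union> W \<Longrightarrow> card (A (J i W) - W) \<le> card (A j - W)" if "i \<in> I" for i W
    using arg_min_nat_lemma[of "\<lambda>j. j \<in> I \<and> A j \<subseteq> A i \<union> W" i "\<lambda>j. card (A j - W)"] that
    unfolding J_def by auto
  define \<chi> where "\<chi> i W = A (J i W) - W" for i W
  define B where "B Z = A (SOME j. j \<in> I \<and> A j \<subseteq> Z)" for Z
  have B: "\<exists>j\<in>I. B Z = A j \<and> A j \<subseteq> Z" if "i \<in> I" "A i \<subseteq> Z" for i Z
    using someI[of "\<lambda>j. j \<in> I \<and> A j \<subseteq> Z" i] that unfolding B_def by blast
  have key: "m \<le> card (A i \<inter> B (W \<union> A i))" if iW: "i \<in> I" "m \<le> card (\<chi> i W)" for i W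
  proof -
    obtain j where j: "j \<in> I" "B (W \<union> A i) = A j" "A j \<subseteq> W \<union> A i"
        using B[OF iW(1), of "W \<union> A i"] by blast
    have "card (\<chi> i W) \<le> card (A j - W)"
      unfolding \<chi>_def using J(3)[OF iW(1) j(1), of W] j(3) by (simp add: Un_commute)
    also have "\<dots> \<le> card (A i \<inter> B (W \<union> A i))"
      using j finite_subset[OF S'(2)[OF iW(1)] fin] by (intro card_mono) auto
    finally show ?thesis using iW by simp
  qed
  have "expect p \<Omega> (\<lambda>W. real (card {i\<in>I. m \<le> card (\<chi> i W)}))
      = expect p \<Omega> (\<lambda>W. \<Sum>i\<in>I. of_bool (m \<le> card (\<chi> i W)))"
    by (simp add: card_Collect_eq_sum_of_bool[OF S'(1)])
  also have "\<dots> = (\<Sum>i\<in>I. expect p \<Omega> (\<lambda>W. of_bool (m \<le> card (\<chi> i W))))"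
    by (rule expect_sum)
  also have "\<dots> \<le> (\<Sum>i\<in>I. expect p \<Omega> (\<lambda>W. of_bool (m \<le> card (A i \<inter> B (W \<union> A i)))))"
    using p key by (intro sum_mono expect_mono) auto
  also have "\<dots> \<le> (\<Sum>i\<in>I. expect p \<Omega> (\<lambda>Z. of_bool (A i \<subseteq> Z) * of_bool (m \<le> card (A i \<inter> B Z))) / p ^ k)"
  proof (intro sum_mono)
    fix i assume i: "i \<in> I"
    define E where "E = expect p \<Omega> (\<lambda>W. of_bool (m \<le> card (A i \<inter> B (W \<union> A i))))"
    have "0 \<le> E" unfolding E_def expect_def using p by (intro sum_nonneg) auto
    moreover have "p ^ k \<le> p ^ card (A i)" using p S'(3)[OF i] by (intro power_decreasing) auto
    ultimately have "p ^ k * E \<le> p ^ card (A i) * E" by (rule mult_right_mono[rotated])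
    also have "\<dots> = expect p \<Omega> (\<lambda>Z. of_bool (A i \<subseteq> Z) * of_bool (m \<le> card (A i \<inter> B Z)))"
      unfolding E_def using expect_superset[OF fin S'(2)[OF i], of p "\<lambda>Z. of_bool (m
          \<le> card (A i \<inter> B Z))"] by simp
    finally show "E \<le> expect p \<Omega> (\<lambda>Z. of_bool (A i \<subseteq> Z) * of_bool (m \<le> card (A i \<inter> B Z))) / p ^ k"
      using p by (simp add: field_simps)
  qed
  also have "\<dots> = expect p \<Omega> (\<lambda>Z. \<Sum>i\<in>I. of_bool (A i \<subseteq> Z) * of_bool (m \<le> card (A i \<inter> B Z))) / p ^ k"
    by (simp add: expect_sum sum_divide_distrib)
  also have "\<dots> \<le> expect p \<Omega> (\<lambda>Z. real (k choose m) * M / R ^ m) / p ^ k"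
  proof (intro divide_right_mono expect_mono)
    fix Z
    have "(\<Sum>i\<in>I. of_bool (A i \<subseteq> Z) * of_bool (m \<le> card (A i \<inter> B Z)) :: real)
        = (\<Sum>i\<in>I. of_bool (A i \<subseteq> Z \<and> m \<le> card (A i \<inter> B Z)))"
      by (intro sum.cong) (auto simp: of_bool_def)
    also have "\<dots> = real (card {i\<in>I. A i \<subseteq> Z \<and> m \<le> card (A i \<inter> B Z)})"
      by (simp add: card_Collect_eq_sum_of_bool[OF S'(1)])
    also have "\<dots> \<le> real (k choose m) * M / R ^ m"
    proof (cases "\<exists>i\<in>I. A i \<subseteq> Z")
      case True
      then obtain j where j: "j \<in> I" "B Z = A j" using B by blast
      have "card {i\<in>I. A i \<subseteq> Z \<and> m \<le> card (A i \<inter> B Z)} \<le> card {i\<in>I. m \<le> card (A i \<inter> B Z)}"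
        using S'(1) by (intro card_mono) auto
      also have "real \<dots> \<le> real (k choose m) * M / R ^ m"
        using spread_family_large_intersection[OF S fin R, of "B Z" m] j S' by auto
      finally show ?thesis by simp
    next
      \<comment> \<open>If no member lies inside Z, the value of \<open>B Z\<close> is arbitrary,
        but then nothing is counted.\<close>
      case False
      then have *: "{i\<in>I. A i \<subseteq> Z \<and> m \<le> card (A i \<inter> B Z)} = {}" by auto
      show ?thesis unfolding * using M0 R by simp
    qed
    finally show "(\<Sum>i\<in>I. of_bool (A i \<subseteq> Z) * of_bool (m \<le> card (A i \<inter> B Z)))
        \<le> real (k choose m) * M / R ^ m" .
  qed (use p in auto)
  also have "\<dots> = real (k choose m) * M / (p ^ k * R ^ m)"
    using fin by simp
  finally have "expect p \<Omega> (\<lambda>W. real (card {i\<in>I. m \<le> card (\<chi> i W)}))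
      \<le> real (k choose m) * M / (p ^ k * R ^ m)" .
  moreover have "\<chi> i W \<subseteq> A i" "A (J i W) \<subseteq> W \<union> \<chi> i W" if "i \<in> I" for i W
    using J(2)[OF that, of W] by (auto simp: \<chi>_def)
  ultimately show thesis
    using J(1) by (intro that[of \<chi>]) blast+
qed

text \<open>\<open>X\<close> counts the members inside W, each weighted to have mean 1, so its mean
  is \<open>card I\<close>; spreadness bounds the mean of its square. In place of Cauchy-Schwarz, a
  quadratic in \<open>X\<close> that lies pointwise below the indicator of the event is
  averaged.\<close>

lemma spread_family_second_moment:
  fixes A :: "'i \<Rightarrow> 'a set"
  assumes S: "spread_family \<Omega> R M m I A" and fin: "finite \<Omega>" and p: "0 < p" "p \<le> 1"
    and R: "R > 0" and M: "M > 0"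
  shows "real (card I) / M * (1 - real m / (p * R)) \<le> expect p \<Omega> (\<lambda>W. of_bool (\<exists>i\<in>I. A i \<subseteq> W))"
proof -
  note S' = spread_familyD[OF S]
  have finA: "finite (A i)" if "i \<in> I" for i using S'(2)[OF that] fin finite_subset by auto
  define y where "y = 1 / (p * R)"
  have y: "y > 0" using p R by (simp add: y_def)
  define K where "K = (1 + y) ^ m"
  have K: "K > 0" using y by (simp add: K_def)
  define X where "X W = (\<Sum>i\<in>I. of_bool (A i \<subseteq> W) * (1 / p) ^ card (A i))" for W
  have E1: "expect p \<Omega> X = real (card I)"
  proof -
    have "expect p \<Omega> X = (\<Sum>i\<in>I. expect p \<Omega> (\<lambda>W. (1 / p) ^ card (A i) * of_bool (A i \<subseteq> W)))"
      unfolding X_def by (simp add: expect_sum mult.commute)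
    also have "\<dots> = (\<Sum>i\<in>I. 1)"
    proof (intro sum.cong refl)
      fix i assume "i \<in> I"
      then show "expect p \<Omega> (\<lambda>W. (1 / p) ^ card (A i) * of_bool (A i \<subseteq> W)) = 1"
        unfolding expect_cmult using p S'(2) fin by (simp add: expect_prob_superset power_one_over)
    qed
    finally show ?thesis by simp
  qed
  have E2: "expect p \<Omega> (\<lambda>W. X W * X W) \<le> real (card I) * (M * K)"
  proof -
    have "expect p \<Omega> (\<lambda>W. X W * X W)
        = expect p \<Omega> (\<lambda>W. \<Sum>i\<in>I. \<Sum>j\<in>I. (1 / p) ^ card (A i) * (1 / p) ^ card (A j) * of_bool (A i \<union> A j \<subseteq> W))"
      unfolding X_def sum_product by (intro expect_cong sum.cong) auto
    also have "\<dots> = (\<Sum>i\<in>I. \<Sum>j\<in>I. (1 / p) ^ card (A i) * (1 / p) ^ card (A j) * expect p \<Omega> (\<lambda>W. of_bool (A i \<union> A j \<subseteq> W)))"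
      by (simp add: expect_sum expect_cmult)
    also have "\<dots> = (\<Sum>i\<in>I. \<Sum>j\<in>I. (1 / p) ^ card (A i \<inter> A j))"
    proof (intro sum.cong refl)
      fix i j assume ij: "i \<in> I" "j \<in> I"
      have c: "card (A i) + card (A j) = card (A i \<union> A j) + card (A i \<inter> A j)"
        using card_Un_Int[OF finA finA] ij by simp
      have "expect p \<Omega> (\<lambda>W. of_bool (A i \<union> A j \<subseteq> W)) = p ^ card (A i \<union> A j)"
        using S'(2) ij fin by (intro expect_prob_superset) auto
      then show "(1 / p) ^ card (A i) * (1 / p) ^ card (A j) * expect p \<Omega> (\<lambda>W. of_bool (A i \<union> A j \<subseteq> W))
          = (1 / p) ^ card (A i \<inter> A j)"
        using p by (simp add: power_add[symmetric] c) (simp add: power_add power_one_over)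
    qed
    also have "\<dots> \<le> (\<Sum>i\<in>I. M * K)"
    proof (intro sum_mono)
      fix i assume i: "i \<in> I"
      have "(\<Sum>j\<in>I. (1 / p) ^ card (A i \<inter> A j))
          \<le> (\<Sum>j\<in>I. \<Sum>X\<in>Pow (A i). of_bool (X \<subseteq> A j) * (1 / p) ^ card X)"
      proof (intro sum_mono)
        fix j assume j: "j \<in> I"
        \<comment> \<open>Expanding over the subsets X of the intersection turns the sum over j into
          counts of members containing X, to which spreadness applies.\<close>
        have "(1 / p) ^ card (A i \<inter> A j) = (\<Sum>X\<in>Pow (A i \<inter> A j). (1 / p - 1) ^ card X)"
          using sum_Pow_power[of "A i \<inter> A j" "1 / p - 1"] finA[OF i] by simp
        also have "\<dots> \<le> (\<Sum>X\<in>Pow (A i \<inter> A j). (1 / p) ^ card X)"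
          using p by (intro sum_mono power_mono) auto
        also have "\<dots> = (\<Sum>X\<in>Pow (A i \<inter> A j). of_bool (X \<subseteq> A j) * (1 / p) ^ card X)"
          by (intro sum.cong) auto
        also have "\<dots> \<le> (\<Sum>X\<in>Pow (A i). of_bool (X \<subseteq> A j) * (1 / p) ^ card X)"
          using p finA[OF i] by (intro sum_mono2) auto
        finally show "(1 / p) ^ card (A i \<inter> A j)
            \<le> (\<Sum>X\<in>Pow (A i). of_bool (X \<subseteq> A j) * (1 / p) ^ card X)" .
      qed
      also have "\<dots> = (\<Sum>X\<in>Pow (A i). \<Sum>j\<in>I. of_bool (X \<subseteq> A j) * (1 / p) ^ card X)"
        by (rule sum.swap)
      also have "\<dots> = (\<Sum>X\<in>Pow (A i). real (card {j\<in>I. X \<subseteq> A j}) * (1 / p) ^ card X)"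
        by (simp add: card_Collect_eq_sum_of_bool[OF S'(1)] sum_distrib_right)
      also have "\<dots> \<le> (\<Sum>X\<in>Pow (A i). M * y ^ card X)"
      proof (intro sum_mono)
        fix X assume "X \<in> Pow (A i)"
        then have "real (card {j\<in>I. X \<subseteq> A j}) * R ^ card X \<le> M" using S'(2,4) i by blast
        then show "real (card {j\<in>I. X \<subseteq> A j}) * (1 / p) ^ card X \<le> M * y ^ card X"
          using p R by (simp add: y_def power_one_over power_mult_distrib field_simps)
      qed
      also have "\<dots> = M * (1 + y) ^ card (A i)"
        using sum_Pow_power[OF finA[OF i], of y] by (simp add: sum_distrib_left[symmetric])
      also have "\<dots> \<le> M * K"
        unfolding K_def using M y S'(3)[OF i] by (intro mult_left_mono power_increasing) auto
      finally show "(\<Sum>j\<in>I. (1 / p) ^ card (A i \<inter> A j)) \<le> M * K" .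
    qed
    finally show ?thesis by simp
  qed
  \<comment> \<open>This value maximises 2 l E X - l^2 E X^2 once the upper bound for E X^2 is
    inserted.\<close>
  define l where "l = 1 / (M * K)"
  have l: "l > 0" using M K by (simp add: l_def)
  have "(1 - real m * y) * K \<le> exp (- (real m * y)) * exp (real m * y)"
  proof (intro mult_mono)
    show "1 - real m * y \<le> exp (- (real m * y))" using exp_ge_add_one_self[of "- (real m * y)"] by simp
    show "K \<le> exp (real m * y)"
      unfolding K_def exp_of_nat_mult using y by (intro power_mono exp_ge_add_one_self) auto
  qed (use K in auto)
  then have K': "1 - real m / (p * R) \<le> 1 / K" using K by (simp add: y_def exp_minus field_simps)
  have "real (card I) / M * (1 - real m / (p * R)) \<le> real (card I) / M * (1 / K)"
    using K' M by (intro mult_left_mono) auto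
  also have "\<dots> = 2 * l * real (card I) - l\<^sup>2 * (real (card I) * (M * K))"
    using M K by (simp add: l_def power2_eq_square field_simps)
  also have "\<dots> \<le> 2 * l * expect p \<Omega> X - l\<^sup>2 * expect p \<Omega> (\<lambda>W. X W * X W)"
    using E1 E2 l by (intro diff_mono mult_left_mono) auto
  also have "\<dots> = expect p \<Omega> (\<lambda>W. 2 * l * X W - l\<^sup>2 * (X W * X W))"
    by (simp add: expect_diff expect_cmult)
  also have "\<dots> \<le> expect p \<Omega> (\<lambda>W. of_bool (\<exists>i\<in>I. A i \<subseteq> W))"
  proof (intro expect_mono)
    fix W
    show "2 * l * X W - l\<^sup>2 * (X W * X W) \<le> of_bool (\<exists>i\<in>I. A i \<subseteq> W)"
    proof (cases "\<exists>i\<in>I. A i \<subseteq> W")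
      case True
      have "0 \<le> (1 - l * X W)\<^sup>2" by simp
      then show ?thesis using True by (simp add: power2_eq_square algebra_simps)
    next
      case False
      then have "X W = 0" unfolding X_def by (intro sum.neutral) auto
      then show ?thesis by simp
    qed
  qed (use p in auto)
  finally show ?thesis .
qed

lemma spread_family_refine:
  assumes S: "spread_family \<Omega> R M k I A" and "I' \<subseteq> I" "\<And>i. i \<in> I' \<Longrightarrow> B i \<subseteq> A i"
    "\<And>i. i \<in> I' \<Longrightarrow> card (B i) \<le> k'" "R > 0"
  shows "spread_family \<Omega> R M k' I' B"
  unfolding spread_family_def
proof (intro conjI ballI allI impI)
  note S' = spread_familyD[OF S]
  show "finite I'" using S'(1) assms(2) by (rule finite_subset[rotated])
  fix X assume X: "X \<subseteq> \<Omega>"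
  have "{i\<in>I'. X \<subseteq> B i} \<subseteq> {i\<in>I. X \<subseteq> A i}"
    using assms(2,3) by blast
  then have "card {i\<in>I'. X \<subseteq> B i} \<le> card {i\<in>I. X \<subseteq> A i}"
    using S'(1) by (intro card_mono) auto
  then have "real (card {i\<in>I'. X \<subseteq> B i}) * R ^ card X \<le> real (card {i\<in>I. X \<subseteq> A i}) * R ^ card X"
    using assms by (intro mult_right_mono) auto
  also have "\<dots> \<le> M" using S'(4)[OF X] .
  finally show "real (card {i\<in>I'. X \<subseteq> B i}) * R ^ card X \<le> M" .
next
  fix i assume i: "i \<in> I'"
  then have "B i \<subseteq> A i" "A i \<subseteq> \<Omega>" using assms(2,3) spread_familyD(2)[OF S] by blast+
  then show "B i \<subseteq> \<Omega>" by blast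
  show "card (B i) \<le> k'" using assms(4) i .
qed

text \<open>A random set of density 1/8 replaces the members by fragments of at most a quarter of
  the size. The indices with larger fragments number at most M / 16 on average and are dropped,
  which adds 1/16 to the loss d. If a second random set contains a fragment, the two together
  contain a member, possibly one of another index. The premise \<open>next_round\<close> ranges over
  all families so that rounds chain by resolution.\<close>

lemma spread_family_round:
  fixes I :: "'i set" and A :: "'i \<Rightarrow> 'a set"
  assumes S: "spread_family \<Omega> R M k I A" and fin: "finite \<Omega>" and R: "R \<ge> 2 ^ 17" and M: "M > 0"
    and p: "0 \<le> p" "p \<le> 1" and c: "c \<ge> 0"
    and next_round: "\<And>(J :: 'i set) (B :: 'i \<Rightarrow> 'a set). spread_family \<Omega> R M (k div 4) J B \<Longrightarrow>
      c * (real (card J) / M - d) \<le> expect p \<Omega> (\<lambda>W. of_bool (\<exists>i\<in>J. B i \<subseteq> W))"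
  shows "c * (real (card I) / M - (d + 1 / 16))
    \<le> expect (1 / 8 + p - 1 / 8 * p) \<Omega> (\<lambda>W. of_bool (\<exists>i\<in>I. A i \<subseteq> W))"
proof -
  define m where "m = k div 4 + 1"
  have R0: "R > 0" using R by (rule less_le_trans[rotated]) simp
  obtain \<chi> where chi: "\<And>i W. i \<in> I \<Longrightarrow> \<chi> i W \<subseteq> A i"
      "\<And>i W. i \<in> I \<Longrightarrow> \<exists>j\<in>I. A j \<subseteq> W \<union> \<chi> i W"
      "expect (1/8) \<Omega> (\<lambda>W. real (card {i\<in>I. m \<le> card (\<chi> i W)}))
          \<le> real (k choose m) * M / ((1/8) ^ k * R ^ m)"
    by (rule fragmentation[OF S fin _ _ R0, of "1/8" m]) auto
  \<comment> \<open>\<open>m\<close> is the first forbidden fragment size; 4 m > k gives 4 k + 4 <=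
    16 m, so that R ^ m is at least 16 * 2 ^ k * 8 ^ k.\<close>
  have "real (k choose m) * 16 * 8 ^ k \<le> 2 ^ k * 16 * 8 ^ k"
  proof (intro mult_right_mono)
    have "real (k choose m) \<le> real (2 ^ k)" using binomial_le_pow2 by (rule of_nat_mono)
    then show "real (k choose m) \<le> 2 ^ k" by simp
  qed auto
  also have "\<dots> = (2 :: real) ^ (4 * k + 4)"
  proof -
    have "(16 :: real) ^ k = 2 ^ k * 8 ^ k" by (simp flip: power_mult_distrib)
    then show ?thesis by (simp add: power_add power_mult)
  qed
  also have "\<dots> \<le> 2 ^ (17 * m)" by (intro power_increasing) (auto simp: m_def)
  also have "\<dots> \<le> R ^ m" unfolding power_mult using R by (intro power_mono) auto
  finally have "real (k choose m) * 16 * 8 ^ k \<le> R ^ m" .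
  then have "real (k choose m) * M / ((1/8) ^ k * R ^ m) \<le> M / 16"
    using M R0 by (simp add: power_one_over field_simps)
  with chi(3) have bad: "expect (1/8) \<Omega> (\<lambda>W. real (card {i\<in>I. m \<le> card (\<chi> i W)})) \<le> M / 16"
    by linarith
  define G where "G U = {i\<in>I. \<not> m \<le> card (\<chi> i U)}" for U
  have G: "real (card (G U)) = real (card I) - real (card {i\<in>I. m \<le> card (\<chi> i U)})" for U
  proof -
    have "G U = I - {i\<in>I. m \<le> card (\<chi> i U)}" by (auto simp: G_def)
    then show ?thesis
      using spread_familyD(1)[OF S] by (simp add: card_Diff_subset card_mono of_nat_diff)
  qed
  have "c * (real (card I) / M - (d + 1 / 16)) \<le>
      c * ((real (card I) - expect (1/8) \<Omega> (\<lambda>W. real (card {i\<in>I. m \<le> card (\<chi> i W)}))) / M - d)"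
    using bad M by (intro mult_left_mono c) (auto simp: field_simps)
  also have "\<dots> = expect (1/8) \<Omega> (\<lambda>U. c * (real (card (G U)) / M - d))"
    unfolding G divide_inverse using fin
    by (simp add: expect_cmult expect_diff mult.commute[of _ "inverse M"])
  also have "\<dots> \<le> expect (1/8) \<Omega> (\<lambda>U. expect p \<Omega> (\<lambda>V. of_bool (\<exists>i\<in>I. A i \<subseteq> U \<union> V)))"
  proof (intro expect_mono)
    fix U
    have "spread_family \<Omega> R M (k div 4) (G U) (\<lambda>i. \<chi> i U)"
      by (rule spread_family_refine[OF S]) (use chi R0 in \<open>auto simp: G_def m_def\<close>)
    from next_round[OF this]
    have "c * (real (card (G U)) / M - d) \<le> expect p \<Omega> (\<lambda>V. of_bool (\<exists>i\<in>G U. \<chi> i U \<subseteq> V))" .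
    also have "\<dots> \<le> expect p \<Omega> (\<lambda>V. of_bool (\<exists>i\<in>I. A i \<subseteq> U \<union> V))"
    proof (intro expect_mono p)
      fix V
      have "\<exists>j\<in>I. A j \<subseteq> U \<union> V" if "i \<in> G U" "\<chi> i U \<subseteq> V" for i
        using chi(2)[of i U] that unfolding G_def by blast
      then show "(of_bool (\<exists>i\<in>G U. \<chi> i U \<subseteq> V) :: real) \<le> of_bool (\<exists>i\<in>I. A i \<subseteq> U \<union> V)"
        by (auto simp: of_bool_def)
    qed
    finally show "c * (real (card (G U)) / M - d) \<le> expect p \<Omega> (\<lambda>V. of_bool (\<exists>i\<in>I. A i \<subseteq> U \<union> V))" .
  qed auto
  also have "\<dots> = expect (1 / 8 + p - 1 / 8 * p) \<Omega> (\<lambda>W. of_bool (\<exists>i\<in>I. A i \<subseteq> W))"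
    by (rule expect_Un[OF fin])
  finally show ?thesis .
qed

text \<open>The bound must be strict, as it is applied both to W and to its complement. The share
  7/8 is what remains of a star after its members meeting another centre are removed.\<close>

lemma spread_family_half:
  fixes I :: "'i set" and A :: "'i \<Rightarrow> 'a set"
  assumes S: "spread_family \<Omega> R M k I A" and fin: "finite \<Omega>" and R: "R \<ge> 2 ^ 17" and M: "M > 0"
    and k: "real k \<le> 4 * R" and I: "7 / 8 * M \<le> real (card I)"
  shows "expect (1 / 2) \<Omega> (\<lambda>W. of_bool (\<exists>i\<in>I. A i \<subseteq> W)) > 1 / 2"
proof -
  have R0: "R > 0" using R by (rule less_le_trans[rotated]) simp
  \<comment> \<open>The last density is chosen so that, after three rounds of density 1/8, the total is 1/2.\<close>
  have final: "3/4 * (real (card J) / M - 0) \<le> expect (87/343) \<Omega> (\<lambda>W. of_bool (\<exists>i\<in>J. B i \<subseteq> W))"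
    if J: "spread_family \<Omega> R M (k div 4 div 4 div 4) J B" for J :: "'i set" and B :: "'i \<Rightarrow> 'a set"
  proof -
    have "real (k div 4 div 4 div 4) \<le> R / 16"
    proof -
      have "64 * (k div 4 div 4 div 4) \<le> k" by simp
      then have "64 * real (k div 4 div 4 div 4) \<le> real k" by linarith
      then show ?thesis using k by linarith
    qed
    \<comment> \<open>With m <= R / 16 the ratio is at most 343 / (16 * 87), just below 1/4, so the
      second moment bound keeps the factor 3/4.\<close>
    then have "real (k div 4 div 4 div 4) / (87/343 * R) \<le> 1/4"
      using R0 by (simp add: field_simps)
    then have "real (card J) / M * (3/4)
        \<le> real (card J) / M * (1 - real (k div 4 div 4 div 4) / (87/343 * R))"
      using M by (intro mult_left_mono) auto
    also have "\<dots> \<le> expect (87/343) \<Omega> (\<lambda>W. of_bool (\<exists>i\<in>J. B i \<subseteq> W))"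
      by (rule spread_family_second_moment[OF J fin _ _ R0 M]) auto
    finally show ?thesis by simp
  qed
  note r1 = spread_family_round[OF _ fin R M _ _ _ final]
  note r2 = spread_family_round[OF _ fin R M _ _ _ r1]
  note r3 = spread_family_round[OF S fin R M _ _ _ r2]
  have "3/4 * (real (card I) / M - 3/16) \<le> expect (1/2) \<Omega> (\<lambda>W. of_bool (\<exists>i\<in>I. A i \<subseteq> W))"
    using r3 by simp
  \<comment> \<open>The left side is 33/64; 3/16 is the loss of the three rounds.\<close>
  moreover have "3/4 * (7/8 - 3/16) \<le> 3/4 * (real (card I) / M - 3/16)"
    using I M by (intro mult_left_mono diff_right_mono) (auto simp: field_simps)
  ultimately show ?thesis by simp
qed

text \<open>The complement of a random set of density 1/2 has density 1/2 as well. The probabilities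
  that W contains some A i and that \<Omega> - W contains some B j thus add up to more than 1, and
  some W does both.\<close>

lemma spread_families_disjoint_members:
  assumes "spread_family \<Omega> R M k I A" "7 / 8 * M \<le> real (card I)" "M > 0"
    and "spread_family \<Omega> R M' k J B" "7 / 8 * M' \<le> real (card J)" "M' > 0"
    and "finite \<Omega>" "R \<ge> 2 ^ 17" "real k \<le> 4 * R"
  obtains i j where "i \<in> I" "j \<in> J" "A i \<inter> B j = {}"
proof -
  let ?f = "\<lambda>W. of_bool (\<exists>i\<in>I. A i \<subseteq> W) + of_bool (\<exists>j\<in>J. B j \<subseteq> \<Omega> - W) :: real"
  have "1 < expect (1/2) \<Omega> ?f"
    using spread_family_half[OF assms(1,7,8,3,9,2)] spread_family_half[OF assms(4,7,8,6,9,5)]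
      expect_compl[OF assms(7), of "1/2" "\<lambda>W. of_bool (\<exists>j\<in>J. B j \<subseteq> W)"]
    by (simp add: expect_add)
  moreover have "expect (1/2) \<Omega> ?f \<le> expect (1/2) \<Omega> (\<lambda>_. 1)" if "\<And>W. W \<subseteq> \<Omega> \<Longrightarrow> ?f W \<le> 1"
    using that by (intro expect_mono) auto
  ultimately obtain W where "\<not> ?f W \<le> 1" using assms(7) by fastforce
  then have "(\<exists>i\<in>I. A i \<subseteq> W) \<and> (\<exists>j\<in>J. B j \<subseteq> \<Omega> - W)"
    by (auto simp: of_bool_def split: if_splits)
  then show thesis using that by blast
qed

section \<open>Spanning trees containing a forest\<close>

lemma finite_Kn_edges [simp]: "finite (Kn_edges n)"
  by (rule finite_subset[of _ "Pow {1..n}"]) (auto simp: Kn_edges_def)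

lemma Kn_edgesE:
  assumes "e \<in> Kn_edges n"
  obtains u v where "e = {u, v}" "u \<noteq> v" "u \<in> {1..n}" "v \<in> {1..n}"
  using assms by (auto simp: Kn_edges_def card_2_iff)

lemma Kn_edgesI: "u \<noteq> v \<Longrightarrow> u \<in> {1..n} \<Longrightarrow> v \<in> {1..n} \<Longrightarrow> {u, v} \<in> Kn_edges n"
  by (auto simp: Kn_edges_def)

lemma adj_mono: "X \<subseteq> Y \<Longrightarrow> adj X \<subseteq> adj Y"
  by (auto simp: adj_def)

lemma sym_adj: "sym (adj X)"
  by (auto simp: adj_def sym_def insert_commute)

lemma reach_sym: "(u, v) \<in> (adj X)\<^sup>* \<Longrightarrow> (v, u) \<in> (adj X)\<^sup>*"
  using sym_rtrancl[OF sym_adj] by (rule symD)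

lemma reach_mono: "(u, v) \<in> (adj X)\<^sup>* \<Longrightarrow> X \<subseteq> Y \<Longrightarrow> (u, v) \<in> (adj Y)\<^sup>*"
  using rtrancl_mono[OF adj_mono] by blast

lemma adj_insert: "u \<noteq> v \<Longrightarrow> adj (insert {u, v} X) = insert (u, v) (insert (v, u) (adj X))"
  by (auto simp: adj_def doubleton_eq_iff)

text \<open>A path needs the new edge at most once, in one of two directions. \<open>adj\<close>
  gains both orientations, so \<open>rtrancl_insert\<close> applies twice and symmetry removes the
  redundant cases.\<close>

lemma reach_insert:
  assumes "u \<noteq> v"
  shows "(x, y) \<in> (adj (insert {u, v} X))\<^sup>* \<longleftrightarrow> (x, y) \<in> (adj X)\<^sup>* \<or>
     (x, u) \<in> (adj X)\<^sup>* \<and> (v, y) \<in> (adj X)\<^sup>* \<or> (x, v) \<in> (adj X)\<^sup>* \<and> (u, y) \<in> (adj X)\<^sup>*"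
  unfolding adj_insert[OF assms] rtrancl_insert
  by (auto intro: reach_sym dest: reach_sym rtrancl_trans)

definition component :: "nat set set \<Rightarrow> nat \<Rightarrow> nat set" where
  "component X v = (adj X)\<^sup>* `` {v}"

text \<open>An isolated vertex is a component of size 1: a forest with k edges thus has n - k
  components, and isolated vertices do not affect \<open>weight\<close>.\<close>

definition components :: "nat \<Rightarrow> nat set set \<Rightarrow> nat set set" where
  "components n X = component X ` {1..n}"

definition weight :: "nat \<Rightarrow> nat set set \<Rightarrow> nat" where
  "weight n X = (\<Prod>C\<in>components n X. card C)"

lemma mem_component: "w \<in> component X v \<longleftrightarrow> (v, w) \<in> (adj X)\<^sup>*"
  by (simp add: component_def)

lemma self_in_component [simp]: "v \<in> component X v"
  by (simp add: mem_component)

lemma component_eq_iff: "component X u = component X v \<longleftrightarrow> (u, v) \<in> (adj X)\<^sup>*"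
proof
  assume "component X u = component X v"
  then have "v \<in> component X u" by simp
  then show "(u, v) \<in> (adj X)\<^sup>*" by (simp add: mem_component)
next
  assume "(u, v) \<in> (adj X)\<^sup>*"
  then show "component X u = component X v"
    using reach_sym[of u v X] by (auto simp: component_def intro: rtrancl_trans)
qed

lemma component_eq_iff_mem: "component X u = component X v \<longleftrightarrow> u \<in> component X v"
  using reach_sym by (auto simp: component_eq_iff mem_component)

lemma component_subset:
  assumes "X \<subseteq> Kn_edges n" "v \<in> {1..n}"
  shows "component X v \<subseteq> {1..n}"
proof
  fix w assume "w \<in> component X v"
  then have "(v, w) \<in> (adj X)\<^sup>*" by (simp add: mem_component)
  then show "w \<in> {1..n}"
    using assms(2)
  proof (induction rule: rtrancl_induct)
    case (step y z)
    then have "{y, z} \<in> Kn_edges n" using assms(1) by (auto simp: adj_def)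
    then show ?case by (auto simp: Kn_edges_def)
  qed auto
qed

lemma finite_component: "X \<subseteq> Kn_edges n \<Longrightarrow> v \<in> {1..n} \<Longrightarrow> finite (component X v)"
  using finite_subset[OF component_subset] by simp

lemma card_component_pos: "X \<subseteq> Kn_edges n \<Longrightarrow> v \<in> {1..n} \<Longrightarrow> 0 < card (component X v)"
  using finite_component by (metis card_gt_0_iff empty_iff self_in_component)

lemma finite_components [simp]: "finite (components n X)"
  by (simp add: components_def)

lemma connected_on_iff_component:
  "connected_on V X \<longleftrightarrow> (\<forall>u\<in>V. \<forall>v\<in>V. component X u = component X v)"
  by (simp add: connected_on_def component_eq_iff)

lemma components_connected:
  assumes "n \<ge> 1" "connected_on {1..n} X"
  shows "components n X = {component X 1}"
proof -
  have "components n X = (\<lambda>_. component X 1) ` {1..n}"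
    unfolding components_def
  proof (rule image_cong)
    fix v assume "v \<in> {1..n}"
    then show "component X v = component X 1"
      using assms(2)[unfolded connected_on_iff_component, rule_format, of v 1] assms(1) by auto
  qed simp
  also have "\<dots> = {component X 1}"
    using assms(1) by (simp add: image_constant_conv)
  finally show ?thesis .
qed

lemma connected_on_iff_components:
  assumes "n \<ge> 1"
  shows "connected_on {1..n} X \<longleftrightarrow> card (components n X) = 1"
proof
  assume "connected_on {1..n} X"
  then have "components n X = {component X 1}"
    using components_connected assms by blast
  then show "card (components n X) = 1" by simp
next
  assume "card (components n X) = 1"
  then obtain C where "components n X = {C}" by (auto simp: card_1_singleton_iff)
  then have "component X v = C" if "v \<in> {1..n}" for v
    using that unfolding components_def by blast
  then show "connected_on {1..n} X" by (simp add: connected_on_iff_component)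
qed

lemma acyclic_graph_mono:
  assumes "acyclic_graph Y" "X \<subseteq> Y"
  shows "acyclic_graph X"
  unfolding acyclic_graph_def
proof (intro allI impI)
  fix u v assume "{u, v} \<in> X" "u \<noteq> v"
  then have "(u, v) \<notin> (adj (Y - {{u, v}}))\<^sup>*" using assms by (auto simp: acyclic_graph_def)
  moreover have "X - {{u, v}} \<subseteq> Y - {{u, v}}" using assms by auto
  ultimately show "(u, v) \<notin> (adj (X - {{u, v}}))\<^sup>*" using reach_mono by blast
qed

text \<open>A cycle through {u, v} would leave a path from u to v in X. A cycle through another edge
  {a, b} must use {u, v}, and the rest of it together with {a, b} would again join u to v inside
  X.\<close>

lemma acyclic_graph_insert:
  assumes "acyclic_graph X" "u \<noteq> v" "(u, v) \<notin> (adj X)\<^sup>*"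
  shows "acyclic_graph (insert {u, v} X)"
  unfolding acyclic_graph_def
proof (intro allI impI notI)
  fix a b assume ab: "{a, b} \<in> insert {u, v} X" "a \<noteq> b"
    and reach: "(a, b) \<in> (adj (insert {u, v} X - {{a, b}}))\<^sup>*"
  show False
  proof (cases "{a, b} = {u, v}")
    case True
    then have "(a, b) \<in> (adj X)\<^sup>*" using reach by (auto elim!: reach_mono)
    moreover have "a = u \<and> b = v \<or> a = v \<and> b = u" using True by (auto simp: doubleton_eq_iff)
    ultimately show False using assms(3) reach_sym by blast
  next
    case False
    define X' where "X' = X - {{a, b}}"
    have X: "{a, b} \<in> X" using ab False by auto
    have eq: "insert {u, v} X - {{a, b}} = insert {u, v} X'" using False by (auto simp: X'_def)
    have sub: "(x, y) \<in> (adj X')\<^sup>* \<Longrightarrow> (x, y) \<in> (adj X)\<^sup>*" for x y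
      by (rule reach_mono) (auto simp: X'_def)
    have "(a, b) \<notin> (adj X')\<^sup>*" using assms(1) X ab(2) by (auto simp: acyclic_graph_def X'_def)
    moreover have "(a, b) \<in> (adj X)\<^sup>*" using X ab(2) by (auto simp: adj_def)
    ultimately show False
      using reach assms(3) sub reach_sym rtrancl_trans unfolding eq reach_insert[OF assms(2)]
      by metis
  qed
qed

lemma acyclic_graph_insertD:
  "acyclic_graph (insert {u, v} X) \<Longrightarrow> {u, v} \<notin> X \<Longrightarrow> u \<noteq> v \<Longrightarrow> (u, v) \<notin> (adj X)\<^sup>*"
  unfolding acyclic_graph_def by (metis Diff_insert_absorb insertI1)

lemma acyclic_graph_insert_iff:
  assumes "acyclic_graph X" "u \<noteq> v"
  shows "{u, v} \<notin> X \<and> acyclic_graph (insert {u, v} X) \<longleftrightarrow> component X u \<noteq> component X v"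
proof -
  have "{u, v} \<in> X \<Longrightarrow> (u, v) \<in> (adj X)\<^sup>*" using assms by (auto simp: adj_def)
  then show ?thesis
    unfolding component_eq_iff
    using acyclic_graph_insert[OF assms] acyclic_graph_insertD[OF _ _ assms(2), of X] by blast
qed

lemma component_insert:
  assumes "u \<noteq> v"
  shows "component (insert {u, v} X) w
    = (if w \<in> component X u \<union> component X v then component X u \<union> component X v else component X w)"
proof (intro set_eqI)
  fix z
  show "z \<in> component (insert {u, v} X) w \<longleftrightarrow>
      z \<in> (if w \<in> component X u \<union> component X v then component X u \<union> component X v else component X w)"
  proof -
    \<comment> \<open>Reachability in X is equality of components, so after rewriting only a
      propositional identity about four components is left.\<close>
    have "(c = d \<or> c = a \<and> b = d \<or> c = b \<and> a = d)
        \<longleftrightarrow> (if a = c \<or> b = c then a = d \<or> b = d else c = d)" for a b c d :: "nat set"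
      by auto
    from this[of "component X w" "component X z" "component X u" "component X v"]
    show ?thesis
      by (simp only: mem_component reach_insert[OF assms] component_eq_iff Un_iff if_distribR if_distrib[of "(\<in>) z"])
  qed
qed

lemma components_insert:
  assumes "u \<noteq> v" "u \<in> {1..n}" "v \<in> {1..n}"
  shows "components n (insert {u, v} X)
    = insert (component X u \<union> component X v) (components n X - {component X u, component X v})"
proof (intro equalityI subsetI)
  fix C assume "C \<in> components n (insert {u, v} X)"
  then obtain w where w: "w \<in> {1..n}" "C = component (insert {u, v} X) w" by (auto simp: components_def)
  show "C \<in> insert (component X u \<union> component X v) (components n X - {component X u, component X v})"
  proof (cases "w \<in> component X u \<union> component X v")
    case True
    then show ?thesis using w by (simp add: component_insert[OF assms(1)])
  next
    case False
    then have "C = component X w" using w by (simp add: component_insert[OF assms(1)])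
    moreover have "component X w \<noteq> component X u" "component X w \<noteq> component X v"
      using False by (auto simp: component_eq_iff_mem)
    ultimately show ?thesis using w(1) unfolding components_def by blast
  qed
next
  fix C assume C: "C \<in> insert (component X u \<union> component X v) (components n X - {component X u, component X v})"
  show "C \<in> components n (insert {u, v} X)"
  proof (cases "C = component X u \<union> component X v")
    case True
    then have "C = component (insert {u, v} X) u" by (simp add: component_insert[OF assms(1)])
    then show ?thesis using assms by (auto simp: components_def)
  next
    case False
    then have "C \<in> components n X" and C': "C \<noteq> component X u" "C \<noteq> component X v"
      using C by blast+
    then obtain w where w: "w \<in> {1..n}" "C = component X w"
      unfolding components_def by blast
    then have "C = component (insert {u, v} X) w"
      using C' by (auto simp: component_insert[OF assms(1)] component_eq_iff_mem)
    then show ?thesis using w by (auto simp: components_def)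
  qed
qed

text \<open>Two factors a and b merge into a single factor a + b and the other components are
  untouched. The ratio is stated crosswise to stay within the natural numbers.\<close>

lemma
  assumes X: "X \<subseteq> Kn_edges n" and uv: "u \<noteq> v" "u \<in> {1..n}" "v \<in> {1..n}"
    and new: "component X u \<noteq> component X v"
  shows card_components_insert: "card (components n X) = Suc (card (components n (insert {u, v} X)))"
    and weight_insert: "weight n (insert {u, v} X) * (card (component X u) * card (component X v))
      = weight n X * (card (component X u) + card (component X v))"
proof -
  define D where "D = components n X - {component X u, component X v}"
  have D: "finite D" by (simp add: D_def)
  have X_eq: "components n X = insert (component X u) (insert (component X v) D)"
    using uv by (auto simp: D_def components_def)
  have eq: "components n (insert {u, v} X) = insert (component X u \<union> component X v) D"
    using components_insert[OF uv] by (simp add: D_def)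
  have notin: "component X u \<union> component X v \<notin> D"
  proof
    assume "component X u \<union> component X v \<in> D"
    then obtain w where "component X u \<union> component X v = component X w" "component X w \<noteq> component X u"
      by (auto simp: D_def components_def)
    then show False by (metis UnI1 component_eq_iff_mem self_in_component)
  qed
  have notin': "component X u \<notin> insert (component X v) D" "component X v \<notin> D"
    using new by (auto simp: D_def)
  have disj: "component X u \<inter> component X v = {}"
    using new by (metis disjoint_iff component_eq_iff_mem)
  have "card (component X u \<union> component X v) = card (component X u) + card (component X v)"
    using disj finite_component[OF X] uv by (intro card_Un_disjoint) auto
  then show "weight n (insert {u, v} X) * (card (component X u) * card (component X v))
      = weight n X * (card (component X u) + card (component X v))"
    unfolding weight_def eq using D notin notin' by (simp add: X_eq)
  show "card (components n X) = Suc (card (components n (insert {u, v} X)))"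
    unfolding eq using D notin notin' by (simp add: X_eq)
qed

lemma component_empty [simp]: "component {} v = {v}"
proof -
  have "adj {} = {}" by (simp add: adj_def)
  then show ?thesis by (simp add: component_def)
qed

lemma components_empty: "components n {} = (\<lambda>v. {v}) ` {1..n}"
  by (simp add: components_def)

lemma card_components_empty: "card (components n {}) = n"
  by (simp add: components_empty card_image)

lemma weight_empty: "weight n {} = 1"
  by (simp add: weight_def components_empty prod.reindex)

text \<open>Builds a forest edge by edge. Beyond plain set induction, the step case provides that
  the new edge joins two different components, which is what the counting lemmas consume.\<close>

lemma acyclic_graph_induct [consumes 2, case_names empty insert]:
  assumes "acyclic_graph X" "X \<subseteq> Kn_edges n"
    and "P {}"
    and "\<And>u v X. u \<noteq> v \<Longrightarrow> u \<in> {1..n} \<Longrightarrow> v \<in> {1..n} \<Longrightarrow> {u, v} \<notin> X \<Longrightarrow> acyclic_graph X \<Longrightarrow>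
      X \<subseteq> Kn_edges n \<Longrightarrow> component X u \<noteq> component X v \<Longrightarrow> P X \<Longrightarrow> P (insert {u, v} X)"
  shows "P X"
proof -
  have "finite X" using assms(2) finite_Kn_edges finite_subset by blast
  then show ?thesis using assms(1,2)
  proof (induction X rule: finite_induct)
    case (insert e X)
    then obtain u v where e: "e = {u, v}" "u \<noteq> v" "u \<in> {1..n}" "v \<in> {1..n}"
      by (auto elim: Kn_edgesE)
    have X: "acyclic_graph X" "X \<subseteq> Kn_edges n"
      using insert.prems by (auto elim: acyclic_graph_mono)
    have "component X u \<noteq> component X v"
      using insert.prems insert.hyps e acyclic_graph_insertD by (auto simp: component_eq_iff)
    then show ?case
      using assms(4)[of u v X] insert e X by auto
  qed (rule assms(3))
qed

lemma card_forest:
  assumes "acyclic_graph X" "X \<subseteq> Kn_edges n"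
  shows "card X + card (components n X) = n"
  using assms
proof (induction rule: acyclic_graph_induct)
  case empty
  then show ?case by (simp add: card_components_empty)
next
  case (insert u v X)
  have "finite X" using insert.hyps finite_Kn_edges finite_subset by blast
  then show ?case
    using insert card_components_insert[of X n u v] by simp
qed

lemma card_spanning_tree:
  assumes "spanning_tree n T" "n \<ge> 1"
  shows "card T = n - 1"
  using assms card_forest[of T n] connected_on_iff_components[OF assms(2), of T]
  by (auto simp: spanning_tree_def)

lemma spanning_tree_finite: "spanning_tree n T \<Longrightarrow> finite T"
  using finite_subset[OF _ finite_Kn_edges] by (auto simp: spanning_tree_def)

text \<open>A maximal forest between X and X \<union> G joins the ends of every edge of G, since
  such an edge could otherwise be added; as G is connected, so is the forest. This completes a
  damaged tree without using forbidden edges.\<close>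

lemma spanning_tree_extension:
  assumes X: "acyclic_graph X" "X \<subseteq> Kn_edges n" and G: "G \<subseteq> Kn_edges n" "connected_on {1..n} G"
  obtains T where "spanning_tree n T" "X \<subseteq> T" "T \<subseteq> X \<union> G"
proof -
  let ?P = "\<lambda>Y. acyclic_graph Y \<and> X \<subseteq> Y \<and> Y \<subseteq> X \<union> G"
  have "finite (X \<union> G)"
    using finite_subset[OF _ finite_Kn_edges] X(2) G(1) by simp
  then have fin: "finite {Y. ?P Y}"
    by (rule rev_finite_subset[OF finite_Pow_iff[THEN iffD2]]) blast
  have ne: "{Y. ?P Y} \<noteq> {}" using X by blast
  obtain T where "T \<in> {Y. ?P Y}" and max: "\<forall>Y\<in>{Y. ?P Y}. T \<subseteq> Y \<longrightarrow> T = Y"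
    by (rule bexE[OF finite_has_maximal[OF fin ne]])
  then have T: "?P T" by simp
  have sub: "T \<subseteq> Kn_edges n" using T X G by auto
  have edge: "(u, v) \<in> (adj T)\<^sup>*" if "(u, v) \<in> adj G" for u v
  proof (rule ccontr)
    assume not: "(u, v) \<notin> (adj T)\<^sup>*"
    have uv: "u \<noteq> v" "{u, v} \<in> G" using that by (auto simp: adj_def)
    have "insert {u, v} T \<in> {Y. ?P Y}" using acyclic_graph_insert[OF _ uv(1) not] T uv by auto
    from bspec[OF max this] have "T = insert {u, v} T" by blast
    then have "{u, v} \<in> T" by blast
    then show False using not uv by (auto simp: adj_def)
  qed
  have "(u, v) \<in> (adj T)\<^sup>*" if "(u, v) \<in> (adj G)\<^sup>*" for u v
    using that by (induction rule: rtrancl_induct) (auto intro: rtrancl_trans edge)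
  then have "connected_on {1..n} T" using G by (auto simp: connected_on_def)
  then show thesis using that T sub by (auto simp: spanning_tree_def)
qed

section \<open>Counting the spanning trees that contain a forest\<close>

definition trees_over :: "nat \<Rightarrow> nat set set \<Rightarrow> nat set set set" where
  "trees_over n X = {T. spanning_tree n T \<and> X \<subseteq> T}"

lemma finite_trees_over [simp]: "finite (trees_over n X)"
  by (rule finite_subset[of _ "Pow (Kn_edges n)"]) (auto simp: trees_over_def spanning_tree_def)

lemma trees_over_empty_iff: "\<not> (acyclic_graph X \<and> X \<subseteq> Kn_edges n) \<Longrightarrow> trees_over n X = {}"
  using acyclic_graph_mono by (auto simp: trees_over_def spanning_tree_def)

text \<open>A component C contributes \<open>card C\<close> terms 1 / \<open>card C\<close>.\<close>

lemma sum_inverse_card_component: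
  assumes "X \<subseteq> Kn_edges n"
  shows "(\<Sum>u\<in>{1..n}. 1 / real (card (component X u))) = real (card (components n X))"
proof -
  have "(\<Sum>u\<in>{1..n}. 1 / real (card (component X u)))
      = (\<Sum>C\<in>components n X. \<Sum>u\<in>{u\<in>{1..n}. component X u = C}. 1 / real (card (component X u)))"
    unfolding components_def by (rule sum.image_gen) auto
  also have "\<dots> = (\<Sum>C\<in>components n X. 1)"
  proof (intro sum.cong refl)
    fix C assume "C \<in> components n X"
    then obtain v where v: "v \<in> {1..n}" "C = component X v" by (auto simp: components_def)
    have "{u\<in>{1..n}. component X u = C} = C"
      using component_subset[OF assms v(1)] v by (auto simp: component_eq_iff_mem)
    moreover have "(\<Sum>u\<in>{u\<in>{1..n}. component X u = C}. 1 / real (card (component X u)))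
        = (\<Sum>u\<in>{u\<in>{1..n}. component X u = C}. 1 / real (card C))"
      by (intro sum.cong) auto
    ultimately show "(\<Sum>u\<in>{u\<in>{1..n}. component X u = C}. 1 / real (card (component X u))) = 1"
      using card_component_pos[OF assms v(1)] v by simp
  qed
  finally show ?thesis by simp
qed

text \<open>Double counting of the pairs of a spanning tree containing the forest and an edge of the
  tree outside the forest.\<close>

lemma card_trees_over_step:
  assumes X: "acyclic_graph X" "X \<subseteq> Kn_edges n" and n: "n \<ge> 1"
  shows "(card (components n X) - 1) * card (trees_over n X)
    = (\<Sum>e | e \<in> Kn_edges n \<and> e \<notin> X \<and> acyclic_graph (insert e X). card (trees_over n (insert e X)))"
proof -
  have "(card (components n X) - 1) * card (trees_over n X)
      = (\<Sum>T\<in>trees_over n X. card {e\<in>Kn_edges n - X. e \<in> T})"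
  proof -
    have "card {e\<in>Kn_edges n - X. e \<in> T} = card (components n X) - 1" if "T \<in> trees_over n X" for T
    proof -
      have T: "spanning_tree n T" "X \<subseteq> T" using that by (auto simp: trees_over_def)
      have "{e\<in>Kn_edges n - X. e \<in> T} = T - X" using T by (auto simp: spanning_tree_def)
      then have "card {e\<in>Kn_edges n - X. e \<in> T} = card T - card X"
        using T spanning_tree_finite[OF T(1)] by (simp add: card_Diff_subset finite_subset)
      then show ?thesis using card_spanning_tree[OF T(1) n] card_forest[OF X] by simp
    qed
    then show ?thesis by simp
  qed
  also have "\<dots> = (\<Sum>T\<in>trees_over n X. \<Sum>e\<in>{e\<in>Kn_edges n - X. e \<in> T}. 1)"
    by simp
  also have "\<dots> = (\<Sum>e\<in>Kn_edges n - X. \<Sum>T\<in>{T\<in>trees_over n X. e \<in> T}. 1)"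
    by (rule sum.swap_restrict) auto
  also have "\<dots> = (\<Sum>e\<in>Kn_edges n - X. card (trees_over n (insert e X)))"
    by (auto intro!: sum.cong arg_cong[where f = card] simp: trees_over_def)
  also have "\<dots> = (\<Sum>e | e \<in> Kn_edges n \<and> e \<notin> X
      \<and> acyclic_graph (insert e X). card (trees_over n (insert e X)))"
  proof (intro sum.mono_neutral_right ballI)
    fix e assume "e \<in> Kn_edges n - X - {e. e \<in> Kn_edges n \<and> e \<notin> X \<and> acyclic_graph (insert e X)}"
    then have "\<not> acyclic_graph (insert e X)" by blast
    then show "card (trees_over n (insert e X)) = 0" by (simp add: trees_over_empty_iff)
  qed auto
  finally show ?thesis .
qed

text \<open>Adding {u, v} multiplies the weight by 1 / c u + 1 / c v. Grouped by endpoint, u lies in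
  n - c u admissible edges and contributes n / c u - 1, and the 1 / c u sum to the number of
  components. The factor (components - 1) is the one of \<open>card_trees_over_step\<close>, so
  weights and tree counts obey the same recursion.\<close>

lemma sum_weight_insert:
  assumes X: "acyclic_graph X" "X \<subseteq> Kn_edges n"
  shows "(\<Sum>e | e \<in> Kn_edges n \<and> e \<notin> X \<and> acyclic_graph (insert e X). real (weight n (insert e X)))
    = real (weight n X) * (real n * (real (card (components n X)) - 1))"
proof -
  define E where "E = {e. e \<in> Kn_edges n \<and> e \<notin> X \<and> acyclic_graph (insert e X)}"
  define c where "c u = real (card (component X u))" for u
  have c: "c u > 0" if "u \<in> {1..n}" for u using card_component_pos[OF X(2) that] by (simp add: c_def)
  have E: "{u, v} \<in> E \<longleftrightarrow> component X u \<noteq> component X v" if "u \<in> {1..n}" "v \<in> {1..n}" for u v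
  proof (cases "u = v")
    case True
    then show ?thesis by (simp add: E_def Kn_edges_def)
  next
    case False
    then show ?thesis using acyclic_graph_insert_iff[OF X(1) False] Kn_edgesI[OF False that]
        by (auto simp: E_def)
  qed
  have finE: "finite E" by (simp add: E_def)
  have "(\<Sum>e\<in>E. real (weight n (insert e X)))
      = (\<Sum>e\<in>E. real (weight n X) * (\<Sum>u\<in>{u\<in>{1..n}. u \<in> e}. 1 / c u))"
  proof (intro sum.cong refl)
    fix e assume e: "e \<in> E"
    then obtain u v where uv: "e = {u, v}" "u \<noteq> v" "u \<in> {1..n}" "v \<in> {1..n}"
      by (auto simp: E_def elim: Kn_edgesE)
    have "{u\<in>{1..n}. u \<in> e} = {u, v}" using uv by auto
    then have s: "(\<Sum>u\<in>{u\<in>{1..n}. u \<in> e}. 1 / c u) = 1 / c u + 1 / c v" using uv by simp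
    have "real (weight n (insert e X)) * (c u * c v) = real (weight n X) * (c u + c v)"
      unfolding c_def uv(1)
      using weight_insert[OF X(2) uv(2-4)] E[OF uv(3,4)] e uv(1) by (metis of_nat_add of_nat_mult)
    then show "real (weight n (insert e X)) = real (weight n X) * (\<Sum>u\<in>{u\<in>{1..n}. u \<in> e}. 1 / c u)"
      unfolding s using c[OF uv(3)] c[OF uv(4)] by (simp add: field_simps)
  qed
  also have "\<dots> = real (weight n X) * (\<Sum>e\<in>E. \<Sum>u\<in>{u\<in>{1..n}. u \<in> e}. 1 / c u)"
    by (simp add: sum_distrib_left)
  also have "(\<Sum>e\<in>E. \<Sum>u\<in>{u\<in>{1..n}. u \<in> e}. 1 / c u) = (\<Sum>u\<in>{1..n}. \<Sum>e\<in>{e\<in>E. u \<in> e}. 1 / c u)"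
    by (rule sum.swap_restrict) (use finE in auto)
  also have "\<dots> = (\<Sum>u\<in>{1..n}. real n * (1 / c u) - 1)"
  proof (intro sum.cong refl)
    fix u assume u: "u \<in> {1..n}"
    have "bij_betw (\<lambda>v. {u, v}) ({1..n} - component X u) {e\<in>E. u \<in> e}"
      unfolding bij_betw_def
    proof
      show "inj_on (\<lambda>v. {u, v}) ({1..n} - component X u)"
        by (auto simp: inj_on_def doubleton_eq_iff)
      show "(\<lambda>v. {u, v}) ` ({1..n} - component X u) = {e\<in>E. u \<in> e}"
      proof (intro equalityI subsetI)
        fix e assume "e \<in> (\<lambda>v. {u, v}) ` ({1..n} - component X u)"
        then show "e \<in> {e\<in>E. u \<in> e}" using E u by (auto simp: component_eq_iff mem_component)
      next
        fix e assume e: "e \<in> {e\<in>E. u \<in> e}"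
        then obtain a b where "e = {a, b}" "a \<noteq> b" "a \<in> {1..n}" "b \<in> {1..n}"
          by (auto simp: E_def elim: Kn_edgesE)
        then obtain v where v: "e = {u, v}" "v \<in> {1..n}" using e by auto
        then show "e \<in> (\<lambda>v. {u, v}) ` ({1..n} - component X u)"
          using e E[OF u, of v] by (auto simp: component_eq_iff mem_component)
      qed
    qed
    then have "card {e\<in>E. u \<in> e} = card ({1..n} - component X u)"
      by (rule bij_betw_same_card[symmetric])
    also have "\<dots> = n - card (component X u)"
      using component_subset[OF X(2) u] finite_component[OF X(2) u] by (simp add: card_Diff_subset)
    finally have "real (card {e\<in>E. u \<in> e}) = real n - c u"
      using card_mono[OF _ component_subset[OF X(2) u]] by (simp add: c_def of_nat_diff)
    then show "(\<Sum>e\<in>{e\<in>E. u \<in> e}. 1 / c u) = real n * (1 / c u) - 1"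
      using c[OF u] by (simp add: field_simps)
  qed
  also have "\<dots> = real n * (real (card (components n X)) - 1)"
    unfolding sum_subtractf sum_distrib_left[symmetric]
    using sum_inverse_card_component[OF X(2)] by (simp add: c_def algebra_simps)
  finally show ?thesis by (simp add: E_def)
qed

text \<open>Induction from forests with few components to forests with more, where the common factor
  m - 1 of the two recursions cancels. The square on the left avoids the exponent m - 2, negative
  for m = 1. The empty forest gives Cayley's formula.\<close>

lemma card_trees_over:
  assumes X: "acyclic_graph X" "X \<subseteq> Kn_edges n" and n: "n \<ge> 1"
  shows "real (card (trees_over n X)) * real n ^ 2 = real (weight n X) * real n ^ card (components n X)"
  using X
proof (induction "card (components n X)" arbitrary: X rule: less_induct)
  case (less X)
  define m where "m = card (components n X)"
  have "m > 0" using n by (auto simp: m_def card_gt_0_iff components_def)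
  then consider "m = 1" | "m > 1" by linarith
  then show ?case
  proof cases
    case 1
    then have conn: "connected_on {1..n} X" using connected_on_iff_components[OF n] by (simp add: m_def)
    then have tree: "spanning_tree n X" using less.prems by (simp add: spanning_tree_def)
    have "trees_over n X = {X}"
    proof -
      have "T = X" if "spanning_tree n T" "X \<subseteq> T" for T
        using card_spanning_tree[OF that(1) n] card_spanning_tree[OF tree n] that(2)
          card_subset_eq[OF spanning_tree_finite[OF that(1)]] by metis
      then show ?thesis using tree by (auto simp: trees_over_def)
    qed
    moreover have "components n X = {{1..n}}"
    proof -
      have "components n X = {component X 1}"
        using components_connected n conn by blast
      moreover have "component X 1 = {1..n}"
        using component_subset[OF less.prems(2), of 1] n conn
        by (auto simp: connected_on_def mem_component)
      ultimately show ?thesis by simp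
    qed
    ultimately show ?thesis by (simp add: weight_def power2_eq_square)
  next
    case 2
    have "(real m - 1) * real (card (trees_over n X)) * real n ^ 2
        = (\<Sum>e | e \<in> Kn_edges n \<and> e \<notin> X
            \<and> acyclic_graph (insert e X). real (card (trees_over n (insert e X))) * real n ^ 2)"
      using arg_cong[OF card_trees_over_step[OF less.prems n], of real] 2
      by (simp add: m_def of_nat_diff sum_distrib_right)
    also have "\<dots> = (\<Sum>e | e \<in> Kn_edges n \<and> e \<notin> X
        \<and> acyclic_graph (insert e X). real (weight n (insert e X)) * real n ^ (m - 1))"
    proof (intro sum.cong refl)
      fix e assume e: "e \<in> {e. e \<in> Kn_edges n \<and> e \<notin> X \<and> acyclic_graph (insert e X)}"
      then obtain u v where uv: "e = {u, v}" "u \<noteq> v" "u \<in> {1..n}" "v \<in> {1..n}"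
        by (auto elim: Kn_edgesE)
      have "component X u \<noteq> component X v"
          using acyclic_graph_insert_iff[OF less.prems(1) uv(2)] e uv by auto
      then have "m = Suc (card (components n (insert e X)))"
        using card_components_insert[OF less.prems(2) uv(2-4)] uv by (simp add: m_def)
      then show "real (card (trees_over n (insert e X))) * real n ^ 2
          = real (weight n (insert e X)) * real n ^ (m - 1)"
        using less.hyps[of "insert e X"] e less.prems by (auto simp: m_def)
    qed
    also have "\<dots> = (real m - 1) * (real (weight n X) * real n ^ m)"
      using power_minus_mult[of m "real n"] 2
      unfolding sum_distrib_right[symmetric] sum_weight_insert[OF less.prems] m_def[symmetric]
      by (simp add: mult_ac)
    finally show ?thesis using 2 by (simp add: m_def)
  qed
qed

section \<open>Matchings have the largest weight\<close>

lemma weight_pos: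
  assumes "X \<subseteq> Kn_edges n"
  shows "0 < weight n X"
  unfolding weight_def using card_component_pos[OF assms] by (intro prod_pos) (auto simp: components_def)

lemma singleton_component_iff:
  assumes "X \<subseteq> Kn_edges n" "v \<in> {1..n}"
  shows "card (component X v) = 1 \<longleftrightarrow> (\<forall>e\<in>X. v \<notin> e)"
proof
  assume "card (component X v) = 1"
  then obtain a where "component X v = {a}" by (auto simp: card_1_singleton_iff)
  moreover from this have "a = v" using self_in_component[of v X] by simp
  ultimately have eq: "component X v = {v}" by simp
  show "\<forall>e\<in>X. v \<notin> e"
  proof (intro ballI notI)
    fix e assume e: "e \<in> X" "v \<in> e"
    then have "e \<in> Kn_edges n" using assms(1) by blast
    then obtain a b where ab: "e = {a, b}" "a \<noteq> b" by (rule Kn_edgesE)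
    define w where "w = (if v = a then b else a)"
    have "(v, w) \<in> adj X" using ab e by (auto simp: w_def adj_def insert_commute)
    then have "w \<in> component X v" by (auto simp: mem_component)
    then show False using eq ab e by (auto simp: w_def split: if_splits)
  qed
next
  assume *: "\<forall>e\<in>X. v \<notin> e"
  have "component X v = {v}"
  proof (intro equalityI subsetI)
    fix w assume "w \<in> component X v"
    then have "(v, w) \<in> (adj X)\<^sup>*" by (simp add: mem_component)
    then show "w \<in> {v}"
      by (cases rule: converse_rtranclE) (use * in \<open>auto simp: adj_def\<close>)
  qed auto
  then show "card (component X v) = 1" by simp
qed

text \<open>Joining components of sizes a and b multiplies the weight by (a + b) / (a b) <= 2, with
  equality only for a = b = 1, that is, if the new edge meets no earlier one.\<close>

lemma weight_bound:
  assumes "acyclic_graph X" "X \<subseteq> Kn_edges n"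
  shows "weight n X \<le> 2 ^ card X \<and> (weight n X = 2 ^ card X \<longleftrightarrow> pairwise disjnt X)"
  using assms
proof (induction rule: acyclic_graph_induct)
  case empty
  then show ?case by (simp add: weight_empty)
next
  case (insert u v X)
  define a b w w' where "a = card (component X u)" and "b = card (component X v)"
    and "w = weight n X" and "w' = weight n (insert {u, v} X)"
  have eq: "w' * (a * b) = w * (a + b)"
    unfolding a_def b_def w_def w'_def using weight_insert insert by auto
  have pos: "a > 0" "b > 0" "w > 0"
    unfolding a_def b_def w_def using card_component_pos weight_pos insert by auto
  have card: "card (insert {u, v} X) = Suc (card X)"
    using insert finite_subset[OF _ finite_Kn_edges] by auto
  have ab: "a + b \<le> 2 * (a * b)" "a + b = 2 * (a * b) \<longleftrightarrow> a = 1 \<and> b = 1"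
  proof -
    obtain a' b' where "a = Suc a'" "b = Suc b'" using pos by (metis gr0_implies_Suc)
    then show "a + b \<le> 2 * (a * b)" "a + b = 2 * (a * b) \<longleftrightarrow> a = 1 \<and> b = 1" by auto
  qed
  have "w' * (a * b) \<le> 2 * w * (a * b)"
    unfolding eq using mult_left_mono[OF ab(1), of w] by (simp add: mult_ac)
  then have le: "w' \<le> 2 * w" using pos by simp
  have "w' = 2 * w \<longleftrightarrow> w' * (a * b) = 2 * w * (a * b)" using pos by simp
  also have "\<dots> \<longleftrightarrow> w * (a + b) = w * (2 * (a * b))" unfolding eq by (simp add: mult_ac)
  also have "\<dots> \<longleftrightarrow> a = 1 \<and> b = 1" using ab(2) pos by simp
  finally have tight: "w' = 2 * w \<longleftrightarrow> a = 1 \<and> b = 1" .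
  have w: "w \<le> 2 ^ card X" "w = 2 ^ card X \<longleftrightarrow> pairwise disjnt X"
    using insert.IH by (auto simp: w_def)
  have "w' = 2 ^ Suc (card X) \<longleftrightarrow> w = 2 ^ card X \<and> w' = 2 * w"
    using le w(1) by auto
  also have "\<dots> \<longleftrightarrow> pairwise disjnt X \<and> (\<forall>e\<in>X. u \<notin> e) \<and> (\<forall>e\<in>X. v \<notin> e)"
    unfolding w tight a_def b_def using singleton_component_iff insert by auto
  also have "\<dots> \<longleftrightarrow> pairwise disjnt (insert {u, v} X)"
    using insert.hyps(4) by (auto simp: pairwise_insert disjnt_def)
  finally show ?case
    using le w(1) unfolding card by (simp add: w'_def)
qed

section \<open>Spread approximation and intersecting families of small sets\<close>

text \<open>G is a star with centre S whose link is R-spread relative to \<open>card G\<close>.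
  Restricting to X above S and cross-multiplying by powers of R avoids forming links and
  dividing.\<close>

definition spread_over :: "'a set \<Rightarrow> real \<Rightarrow> 'a set \<Rightarrow> 'a set set \<Rightarrow> bool" where
  "spread_over \<Omega> R S G \<longleftrightarrow> G \<noteq> {} \<and> (\<forall>A\<in>G. S \<subseteq> A) \<and>
     (\<forall>X\<subseteq>\<Omega>. S \<subseteq> X \<longrightarrow> real (card {A\<in>G. X \<subseteq> A}) * R ^ card X \<le> real (card G) * R ^ card S)"

text \<open>A set S maximising \<open>f\<close> has a spread link, since a larger X violating the
  bound would have a larger value. If S has at most q elements, its star is split off and the rest
  is treated alike. Otherwise the process stops, and comparing \<open>f\<close> at the empty set
  with \<open>f S\<close> bounds all that is left.\<close>

lemma spread_approximation:
  fixes F :: "'a set set"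
  assumes fin: "finite \<Omega>" and F: "F \<subseteq> Pow \<Omega>" and R: "R > 0"
  shows "\<exists>P F'. F' \<subseteq> F
    \<and> (\<forall>(S, G)\<in>P. S \<subseteq> \<Omega> \<and> card S \<le> q \<and> G \<subseteq> F \<and> spread_over \<Omega> R S G)
    \<and> (\<forall>A\<in>F. A \<in> F' \<or> (\<exists>(S, G)\<in>P. A \<in> G))
    \<and> (F' = {} \<or> (\<exists>S\<subseteq>\<Omega>. q < card S \<and> real (card F') \<le> R ^ card S * real (card {A\<in>F. S \<subseteq> A})))"
proof -
  have "finite F" using F fin by (meson finite_Pow_iff finite_subset)
  then show ?thesis using F
  proof (induction F rule: finite_psubset_induct)
    case (psubset F)
    show ?case
    proof (cases "F = {}")
      case True
      then show ?thesis by (intro exI[of _ "{}"]) auto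
    next
      case False
      define f where "f S = real (card {A\<in>F. S \<subseteq> A}) * R ^ card S" for S
      have fin': "finite (f ` Pow \<Omega>)" "f ` Pow \<Omega> \<noteq> {}" using fin by auto
      obtain S where S: "S \<subseteq> \<Omega>" "Max (f ` Pow \<Omega>) = f S"
        using Max_in[OF fin'] by blast
      have Smax: "f X \<le> f S" if "X \<subseteq> \<Omega>" for X
        using Max_ge[OF fin'(1), of "f X"] that by (simp flip: S(2))
      define G where "G = {A\<in>F. S \<subseteq> A}"
      have F_le: "real (card F) \<le> f S" using Smax[of "{}"] by (simp add: f_def)
      have "card F > 0" using False psubset.hyps by auto
      then have "f S > 0" using F_le by linarith
      moreover have "f S = real (card G) * R ^ card S" by (simp add: f_def G_def)
      ultimately have "card G \<noteq> 0" by (intro notI) simp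
      then have G: "G \<noteq> {}" by (intro notI) simp
      have GF: "G \<subseteq> F" by (auto simp: G_def)
      have spread: "spread_over \<Omega> R S G"
        unfolding spread_over_def
      proof (intro conjI allI impI)
        fix X assume X: "X \<subseteq> \<Omega>" "S \<subseteq> X"
        then have "{A\<in>G. X \<subseteq> A} = {A\<in>F. X \<subseteq> A}" by (auto simp: G_def)
        then show "real (card {A\<in>G. X \<subseteq> A}) * R ^ card X \<le> real (card G) * R ^ card S"
          using Smax[OF X(1)] by (simp add: f_def G_def)
      qed (use G in \<open>auto simp: G_def\<close>)
      show ?thesis
      proof (cases "card S \<le> q")
        case True
        have "F - G \<subset> F" using G GF by auto
        from psubset.IH[OF this] psubset.prems obtain P F' where P: "F' \<subseteq> F - G"
            "\<forall>(S, H)\<in>P. S \<subseteq> \<Omega> \<and> card S \<le> q \<and> H \<subseteq> F - G \<and> spread_over \<Omega> R S H"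
            "\<forall>A\<in>F - G. A \<in> F' \<or> (\<exists>(S, H)\<in>P. A \<in> H)"
            "F' = {} \<or> (\<exists>S\<subseteq>\<Omega>. q < card S \<and> real (card F') \<le> R ^ card S * real (card {A\<in>F - G. S \<subseteq> A}))"
          by blast
        show ?thesis
        proof (intro exI conjI)
          show "F' \<subseteq> F" using P(1) by auto
          show "\<forall>(S, H)\<in>insert (S, G) P. S \<subseteq> \<Omega> \<and> card S \<le> q \<and> H \<subseteq> F \<and> spread_over \<Omega> R S H"
            using P(2) S(1) True GF spread by auto
          show "\<forall>A\<in>F. A \<in> F' \<or> (\<exists>(S, H)\<in>insert (S, G) P. A \<in> H)"
            using P(3) by auto
          \<comment> \<open>The remainder is to be bounded through the original F, so the degrees in
            the smaller family are enlarged.\<close>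
          have "card {A\<in>F - G. X \<subseteq> A} \<le> card {A\<in>F. X \<subseteq> A}" for X
            using psubset.hyps by (intro card_mono) auto
          then have "R ^ card X * real (card {A\<in>F - G. X \<subseteq> A})
              \<le> R ^ card X * real (card {A\<in>F. X \<subseteq> A})" for X
            using R by (intro mult_left_mono) auto
          then show "F' = {} \<or> (\<exists>S\<subseteq>\<Omega>. q < card S \<and> real (card F')
              \<le> R ^ card S * real (card {A\<in>F. S \<subseteq> A}))"
            using P(4) order_trans by blast
        qed
      next
        case False
        have "real (card F) \<le> R ^ card S * real (card {A\<in>F. S \<subseteq> A})"
          using F_le by (simp add: f_def mult.commute)
        then show ?thesis
          using False S(1) by (intro exI[of _ "{}"] exI[of _ F]) auto
      qed
    qed
  qed
qed

text \<open>By spreadness a point outside S lies in at most a 1/R share of G, so avoiding S' - S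
  costs at most card S' / R <= 1/8. The normaliser of the surviving links remains
  \<open>card G\<close>.\<close>

lemma spread_over_avoid:
  assumes G: "spread_over \<Omega> R S G" "finite G" "\<And>A. A \<in> G \<Longrightarrow> A \<subseteq> \<Omega>" "\<And>A. A \<in> G \<Longrightarrow> card A \<le> k"
    and fin: "finite \<Omega>" and S: "S \<subseteq> \<Omega>" "S' \<subseteq> \<Omega>" and R: "R > 0" "8 * real (card S') \<le> R"
  shows "7 / 8 * real (card G) \<le> real (card {A\<in>G. A \<inter> (S' - S) = {}})" (is "_ \<le> real (card ?H)")
    and "spread_family \<Omega> R (real (card G)) k {A\<in>G. A \<inter> (S' - S) = {}} (\<lambda>A. A - S)"
proof -
  have SA: "S \<subseteq> A" if "A \<in> G" for A using G(1) that by (auto simp: spread_over_def)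
  have spread: "real (card {A\<in>G. X \<subseteq> A}) * R ^ card X \<le> real (card G) * R ^ card S"
    if "X \<subseteq> \<Omega>" "S \<subseteq> X" for X using G(1) that by (auto simp: spread_over_def)
  have finS: "finite S" "finite S'" using S fin finite_subset by auto
  have "card (G - ?H) \<le> card (\<Union>x\<in>S' - S. {A\<in>G. insert x S \<subseteq> A})"
    using SA G(2) finS by (intro card_mono) auto
  also have "\<dots> \<le> (\<Sum>x\<in>S' - S. card {A\<in>G. insert x S \<subseteq> A})"
    using finS by (intro card_UN_le) auto
  finally have "real (card (G - ?H)) \<le> (\<Sum>x\<in>S' - S. real (card {A\<in>G. insert x S \<subseteq> A}))"
    by (simp flip: of_nat_sum)
  also have "\<dots> \<le> (\<Sum>x\<in>S' - S. real (card G) / R)"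
  proof (intro sum_mono)
    fix x assume x: "x \<in> S' - S"
    have "real (card {A\<in>G. insert x S \<subseteq> A}) * R ^ card (insert x S) \<le> real (card G) * R ^ card S"
      using x S by (intro spread) auto
    then show "real (card {A\<in>G. insert x S \<subseteq> A}) \<le> real (card G) / R"
      using x finS R by (simp add: field_simps)
  qed
  also have "\<dots> = real (card (S' - S)) * (real (card G) / R)" by simp
  also have "\<dots> \<le> real (card S') * (real (card G) / R)"
    using finS R by (intro mult_right_mono) (auto intro: card_mono)
  also have "\<dots> = real (card G) * (real (card S') / R)" by simp
  also have "\<dots> \<le> real (card G) * (1 / 8)"
    using R by (intro mult_left_mono) (auto simp: field_simps)
  finally have "real (card (G - ?H)) \<le> real (card G) / 8" by simp
  moreover have "card (G - ?H) = card G - card ?H" "card ?H \<le> card G"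
    using G(2) by (auto intro!: card_Diff_subset card_mono)
  ultimately show "7 / 8 * real (card G) \<le> real (card ?H)" by (simp add: of_nat_diff)
  show "spread_family \<Omega> R (real (card G)) k ?H (\<lambda>A. A - S)"
    unfolding spread_family_def
  proof (intro conjI ballI allI impI)
    show "finite ?H" using G(2) by simp
    fix A assume "A \<in> ?H"
    then have A: "A \<in> G" by simp
    show "A - S \<subseteq> \<Omega>" using G(3)[OF A] by auto
    have "finite A" using G(3)[OF A] fin finite_subset by auto
    then have "card (A - S) \<le> card A" by (intro card_mono) auto
    then show "card (A - S) \<le> k" using G(4)[OF A] by simp
  next
    fix X assume X: "X \<subseteq> \<Omega>"
    show "real (card {A\<in>?H. X \<subseteq> A - S}) * R ^ card X \<le> real (card G)"
    proof (cases "X \<inter> S = {}")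
      case True
      have finX: "finite X" using X fin finite_subset by auto
      have "card {A\<in>?H. X \<subseteq> A - S} \<le> card {A\<in>G. S \<union> X \<subseteq> A}"
        using G(2) SA by (intro card_mono) auto
      then have "real (card {A\<in>?H. X \<subseteq> A - S}) * R ^ card (S \<union> X)
          \<le> real (card {A\<in>G. S \<union> X \<subseteq> A}) * R ^ card (S \<union> X)"
        using R by (intro mult_right_mono) auto
      also have "\<dots> \<le> real (card G) * R ^ card S" using X S by (intro spread) auto
      finally have "(real (card {A\<in>?H. X \<subseteq> A - S}) * R ^ card X) * R ^ card S
          \<le> real (card G) * R ^ card S"
        using True finX finS by (simp add: card_Un_disjoint Int_commute power_add mult_ac)
      then show ?thesis using R by simp
    next
      case False
      then have *: "{A\<in>?H. X \<subseteq> A - S} = {}" by auto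
      show ?thesis unfolding * by simp
    qed
  qed
qed

text \<open>Disjointness of A - S and B - S' alone still permits common points in S' - S or S - S',
  so both stars are first thinned to avoid the other centre. This transfers the intersection
  property from the trees to the centres.\<close>

lemma spread_over_members_intersection:
  assumes G: "spread_over \<Omega> R S G" "G \<subseteq> F" and G': "spread_over \<Omega> R S' G'" "G' \<subseteq> F"
    and F: "F \<subseteq> Pow \<Omega>" "\<And>A. A \<in> F \<Longrightarrow> card A \<le> k"
    and S: "S \<subseteq> \<Omega>" "8 * real (card S) \<le> R" and S': "S' \<subseteq> \<Omega>" "8 * real (card S') \<le> R"
    and fin: "finite \<Omega>" and R: "R \<ge> 2 ^ 17" and k: "real k \<le> 4 * R"
  obtains A B where "A \<in> G" "B \<in> G'" "A \<inter> B \<subseteq> S \<inter> S'"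
proof -
  have R0: "R > 0" using R by (rule less_le_trans[rotated]) simp
  have "finite F" using F fin by (meson finite_Pow_iff finite_subset)
  then have finG: "finite G" "finite G'" using G G' finite_subset by auto
  have sub: "A \<subseteq> \<Omega>" "card A \<le> k" if "A \<in> G \<or> A \<in> G'" for A using that F G G' by auto
  have ne: "0 < real (card G)" "0 < real (card G')"
    using G G' finG by (auto simp: spread_over_def card_gt_0_iff)
  note a = spread_over_avoid[OF G(1) finG(1) _ _ fin S(1) S'(1) R0 S'(2), of k]
  note b = spread_over_avoid[OF G'(1) finG(2) _ _ fin S'(1) S(1) R0 S(2), of k]
  obtain A B where "A \<in> {A\<in>G. A \<inter> (S' - S) = {}}" "B \<in> {A\<in>G'. A \<inter> (S - S') = {}}"
      "(A - S) \<inter> (B - S') = {}"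
    by (rule spread_families_disjoint_members[OF a(2,1) ne(1) b(2,1) ne(2) fin R k]) (use sub in auto)
  then show thesis by (intro that[of A B]) auto
qed

section \<open>Minimal intersecting families\<close>

definition intersecting_family :: "nat \<Rightarrow> 'a set set \<Rightarrow> bool" where
  "intersecting_family t \<S> \<longleftrightarrow> (\<forall>A\<in>\<S>. \<forall>B\<in>\<S>. t \<le> card (A \<inter> B))"

definition minimal_intersecting :: "nat \<Rightarrow> 'a set set \<Rightarrow> bool" where
  "minimal_intersecting t \<T> \<longleftrightarrow> intersecting_family t \<T> \<and> (\<forall>T\<in>\<T>. \<forall>X. X \<subset> T \<longrightarrow> (\<exists>Y\<in>\<T>. card (X \<inter> Y) < t))"

text \<open>Among the t-intersecting families that generate \<S>, one of least total cardinality
  works: shrinking a member without losing the intersections would lower the total. Its members need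
  not belong to \<S>.\<close>

lemma minimal_intersecting_exists:
  fixes \<S> :: "'a set set"
  assumes fin: "finite \<Omega>" and S: "\<S> \<subseteq> Pow \<Omega>" "intersecting_family t \<S>" "\<And>A. A \<in> \<S> \<Longrightarrow> card A \<le> s"
  obtains \<T> where "\<T> \<subseteq> Pow \<Omega>" "minimal_intersecting t \<T>" "\<And>T. T \<in> \<T> \<Longrightarrow> card T \<le> s"
    "\<And>A. A \<in> \<S> \<Longrightarrow> \<exists>T\<in>\<T>. T \<subseteq> A"
proof -
  define Q where "Q \<T> \<longleftrightarrow> \<T> \<subseteq> Pow \<Omega> \<and> intersecting_family t \<T> \<and> (\<forall>T\<in>\<T>. card T \<le> s)
      \<and> (\<forall>A\<in>\<S>. \<exists>T\<in>\<T>. T \<subseteq> A)" for \<T>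
  have "Q \<S>" using S by (auto simp: Q_def)
  then obtain \<T> where T: "Q \<T>" and min: "\<And>\<U>. Q \<U> \<Longrightarrow> sum card \<T> \<le> sum card \<U>"
    using ex_has_least_nat[of Q \<S> "sum card"] by auto
  have finT: "finite \<T>" using T fin unfolding Q_def by (meson finite_Pow_iff finite_subset)
  have "\<exists>Y\<in>\<T>. card (X \<inter> Y) < t" if X: "T \<in> \<T>" "X \<subset> T" for T X
  proof (rule ccontr)
    assume "\<not> (\<exists>Y\<in>\<T>. card (X \<inter> Y) < t)"
    then have meets: "t \<le> card (X \<inter> Y)" if "Y \<in> \<T>" for Y using that by (meson not_less)
    have finTX: "finite T" using T X fin finite_subset unfolding Q_def by auto
    have XT: "card X < card T" using X finTX by (simp add: psubset_card_mono)
    define \<U> where "\<U> = insert X (\<T> - {T})"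
    \<comment> \<open>Taking Y = T in \<open>meets\<close> shows that X itself has at least t
      elements, as \<open>intersecting_family\<close> compares a set with itself too.\<close>
    have "X \<inter> T = X" using X by auto
    then have "t \<le> card X" using meets[OF X(1)] by simp
    then have "intersecting_family t \<U>"
      using T meets unfolding Q_def intersecting_family_def \<U>_def by (auto simp: Int_commute)
    moreover have "\<U> \<subseteq> Pow \<Omega>"
      using T X unfolding Q_def \<U>_def by blast
    moreover have "\<forall>T\<in>\<T>. card T \<le> s" using T unfolding Q_def by blast
    then have "\<forall>U\<in>\<U>. card U \<le> s" using XT X(1) unfolding \<U>_def by force
    moreover have "\<exists>U\<in>\<U>. U \<subseteq> A" if A: "A \<in> \<S>" for A
    proof -
      obtain T' where "T' \<in> \<T>" "T' \<subseteq> A" using T A unfolding Q_def by blast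
      then have "X \<subseteq> A \<or> T' \<in> \<U> \<and> T' \<subseteq> A" using X(2) unfolding \<U>_def by blast
      then show ?thesis unfolding \<U>_def by blast
    qed
    ultimately have "Q \<U>" by (simp add: Q_def)
    then have "sum card \<T> \<le> sum card \<U>" by (rule min)
    also have "\<dots> \<le> card X + sum card (\<T> - {T})"
      unfolding \<U>_def using finT by (simp add: sum.insert_if)
    also have "\<dots> < sum card \<T>"
      using XT sum.remove[OF finT X(1), of card] by simp
    finally show False by simp
  qed
  then have "minimal_intersecting t \<T>" using T by (auto simp: minimal_intersecting_def Q_def)
  then show thesis using that T by (auto simp: Q_def)
qed

text \<open>Minimality supplies a set Y meeting X in fewer than t elements; each member containing X meets
  Y in at least t elements, so it contains one of any card Y - t + 1 elements of Y outside X.\<close>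

lemma minimal_intersecting_link_bound:
  assumes T: "minimal_intersecting t \<T>" "finite \<T>" "\<And>T. T \<in> \<T> \<Longrightarrow> finite T \<and> card T \<le> s"
    and X: "card X \<le> s" "finite X"
  shows "card {T\<in>\<T>. card T = s \<and> X \<subseteq> T} \<le> (s - t + 1) ^ (s - card X)"
  using X
proof (induction "s - card X" arbitrary: X)
  case 0
  have "T = X" if "T \<in> \<T>" "card T = s" "X \<subseteq> T" for T
    using card_subset_eq[of T X] T(3)[OF that(1)] that 0 by auto
  then have "{T\<in>\<T>. card T = s \<and> X \<subseteq> T} \<subseteq> {X}" by auto
  then have "card {T\<in>\<T>. card T = s \<and> X \<subseteq> T} \<le> card {X}" by (intro card_mono) auto
  then show ?case using 0 by simp
next
  case (Suc d)
  define W where "W = {T\<in>\<T>. card T = s \<and> X \<subseteq> T}"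
  show ?case
  proof (cases "W = {}")
    case True
    then show ?thesis unfolding W_def[symmetric] by simp
  next
    case False
    then obtain T0 where T0: "T0 \<in> \<T>" "card T0 = s" "X \<subseteq> T0" by (auto simp: W_def)
    \<comment> \<open>X is a proper subset of a member, which is what minimality needs in order to
      supply Y.\<close>
    have "X \<noteq> T0" using T0 Suc by auto
    then have "X \<subset> T0" using T0 by auto
    then obtain Y where Y: "Y \<in> \<T>" "card (X \<inter> Y) < t"
      using T(1) T0(1) unfolding minimal_intersecting_def by blast
    have finY: "finite Y" "card Y \<le> s" using T(3)[OF Y(1)] by auto
    have cY: "card Y = card (X \<inter> Y) + card (Y - X)"
      using card_Int_Diff[OF finY(1), of X] by (simp add: Int_commute)
    have inY: "t \<le> card (X \<inter> Y) + card (U \<inter> (Y - X))" if "U \<in> W" for U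
    proof -
      have U: "U \<in> \<T>" "X \<subseteq> U" using that by (auto simp: W_def)
      have "t \<le> card (U \<inter> Y)"
        using T(1) U Y unfolding minimal_intersecting_def intersecting_family_def by blast
      also have "U \<inter> Y = (X \<inter> Y) \<union> (U \<inter> (Y - X))" using U by auto
      also have "card \<dots> = card (X \<inter> Y) + card (U \<inter> (Y - X))"
        using finY by (intro card_Un_disjoint) auto
      finally show ?thesis .
    qed
    have tY: "t \<le> card Y"
      using T(1) Y(1) unfolding minimal_intersecting_def intersecting_family_def by force
    \<comment> \<open>A set missing all of Z would meet Y in at most \<open>card Y\<close> - c = t -
      1 elements; Z fits into Y - X because X takes at most t - 1 elements of Y.\<close>
    define c where "c = card Y - t + 1"
    have "c \<le> card (Y - X)" using cY Y(2) tY by (simp add: c_def)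
    then obtain Z where Z: "Z \<subseteq> Y - X" "card Z = c" "finite Z"
      by (rule obtain_subset_with_card_n)
    have hit: "\<exists>z\<in>Z. z \<in> U" if "U \<in> W" for U
    proof (rule ccontr)
      assume "\<not> (\<exists>z\<in>Z. z \<in> U)"
      then have "U \<inter> (Y - X) \<subseteq> (Y - X) - Z" by auto
      then have "card (U \<inter> (Y - X)) \<le> card ((Y - X) - Z)" using finY by (intro card_mono) auto
      also have "\<dots> = card (Y - X) - c" using Z by (simp add: card_Diff_subset)
      finally show False using inY[OF that] cY tY \<open>c \<le> card (Y - X)\<close> by (simp add: c_def)
    qed
    have "card W \<le> card (\<Union>z\<in>Z. {T\<in>\<T>. card T = s \<and> insert z X \<subseteq> T})"
    proof (rule card_mono)
      show "W \<subseteq> (\<Union>z\<in>Z. {T\<in>\<T>. card T = s \<and> insert z X \<subseteq> T})"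
      proof
        fix U assume U: "U \<in> W"
        then obtain z where "z \<in> Z" "z \<in> U" using hit by blast
        then show "U \<in> (\<Union>z\<in>Z. {T\<in>\<T>. card T = s \<and> insert z X \<subseteq> T})" using U by (auto simp: W_def)
      qed
    qed (use T(2) Z in auto)
    also have "\<dots> \<le> (\<Sum>z\<in>Z. card {T\<in>\<T>. card T = s \<and> insert z X \<subseteq> T})"
      using Z by (intro card_UN_le)
    also have "\<dots> \<le> (\<Sum>z\<in>Z. (s - t + 1) ^ d)"
    proof (intro sum_mono)
      fix z assume "z \<in> Z"
      then have "z \<notin> X" using Z by auto
      then have c: "card (insert z X) = Suc (card X)" using Suc.prems by simp
      have "card {T\<in>\<T>. card T = s \<and> insert z X \<subseteq> T} \<le> (s - t + 1) ^ (s - card (insert z X))"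
        using Suc.hyps(2) Suc.prems c by (intro Suc.hyps(1)) auto
      then show "card {T\<in>\<T>. card T = s \<and> insert z X \<subseteq> T} \<le> (s - t + 1) ^ d"
      proof -
        have "s - card (insert z X) = d" using Suc.hyps(2) c by simp
        with \<open>card {T\<in>\<T>. card T = s \<and> insert z X \<subseteq> T} \<le> (s - t + 1) ^ (s - card (insert z X))\<close>
        show ?thesis by (simp only:)
      qed
    qed
    also have "\<dots> = c * (s - t + 1) ^ d" using Z by simp
    also have "\<dots> \<le> (s - t + 1) * (s - t + 1) ^ d"
      using finY by (intro mult_right_mono) (auto simp: c_def)
    also have "\<dots> = (s - t + 1) ^ (s - card X)" using Suc.hyps(2)[symmetric] by simp
    finally show ?thesis unfolding W_def .
  qed
qed

text \<open>All members share t elements with one fixed member \<open>T0\<close> of size s, so the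
  link bound is summed over the t-subsets of \<open>T0\<close>.\<close>

lemma minimal_intersecting_layer_bound:
  assumes T: "minimal_intersecting t \<T>" "finite \<T>" "\<And>T. T \<in> \<T> \<Longrightarrow> finite T \<and> card T \<le> s"
    and "t \<le> s"
  shows "card {T\<in>\<T>. card T = s} \<le> (s choose t) * (s - t + 1) ^ (s - t)"
proof (cases "{T\<in>\<T>. card T = s} = {}")
  case False
  then obtain T0 where T0: "T0 \<in> \<T>" "card T0 = s" by auto
  let ?P = "{X. X \<subseteq> T0 \<and> card X = t}"
  have fin0: "finite T0" using T(3) T0 by auto
  have "card {T\<in>\<T>. card T = s} \<le> card (\<Union>X\<in>?P. {T\<in>\<T>. card T = s \<and> X \<subseteq> T})"
  proof (rule card_mono)
    show "{T\<in>\<T>. card T = s} \<subseteq> (\<Union>X\<in>?P. {T\<in>\<T>. card T = s \<and> X \<subseteq> T})"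
    proof
      fix U assume U: "U \<in> {T\<in>\<T>. card T = s}"
      then have "t \<le> card (T0 \<inter> U)"
        using T(1) T0 unfolding minimal_intersecting_def intersecting_family_def by blast
      then obtain X where "X \<subseteq> T0 \<inter> U" "card X = t" by (rule obtain_subset_with_card_n)
      then show "U \<in> (\<Union>X\<in>?P. {T\<in>\<T>. card T = s \<and> X \<subseteq> T})" using U by auto
    qed
  qed (use T(2) fin0 in auto)
  also have "\<dots> \<le> (\<Sum>X\<in>?P. card {T\<in>\<T>. card T = s \<and> X \<subseteq> T})"
    using fin0 by (intro card_UN_le) auto
  also have "\<dots> \<le> (\<Sum>X\<in>?P. (s - t + 1) ^ (s - t))"
  proof (intro sum_mono)
    fix X assume "X \<in> ?P"
    then have "card X = t" "finite X" using fin0 finite_subset by auto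
    then show "card {T\<in>\<T>. card T = s \<and> X \<subseteq> T} \<le> (s - t + 1) ^ (s - t)"
      using minimal_intersecting_link_bound[OF T, of X] assms(4) by simp
  qed
  also have "\<dots> = (s choose t) * (s - t + 1) ^ (s - t)"
    using n_subsets[OF fin0, of t] T0 by simp
  finally show ?thesis .
next
  case True
  show ?thesis unfolding True by simp
qed

text \<open>Passing from j to j + 1 multiplies the left side by (j + 1) (1 + 1 / (j + 1)) ^ (j + 1),
  at most e (j + 1). The factorial will cancel against a binomial coefficient.\<close>

lemma Suc_power_le_fact: "real (j + 1) ^ j \<le> 3 ^ j * fact j"
proof (induction j)
  case (Suc j)
  have "(1 + 1 / real (Suc j)) ^ Suc j \<le> exp (1 / real (Suc j)) ^ Suc j"
    by (intro power_mono exp_ge_add_one_self) auto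
  also have "\<dots> = exp 1" by (subst exp_of_nat_mult[symmetric]) simp
  also have "\<dots> \<le> 3" by (rule exp_le)
  finally have e: "(1 + 1 / real (Suc j)) ^ Suc j \<le> 3" .
  have "real (Suc j + 1) = (1 + 1 / real (Suc j)) * real (Suc j)" by (simp add: field_simps)
  then have "real (Suc j + 1) ^ Suc j = (1 + 1 / real (Suc j)) ^ Suc j * real (Suc j) ^ Suc j"
    by (simp only: power_mult_distrib)
  also have "\<dots> \<le> 3 * real (Suc j) ^ Suc j" using e by (intro mult_right_mono) auto
  also have "\<dots> = 3 * real (Suc j) * real (j + 1) ^ j" by simp
  also have "\<dots> \<le> 3 * real (Suc j) * (3 ^ j * fact j)" using Suc.IH by (intro mult_left_mono) auto
  also have "\<dots> = 3 ^ Suc j * fact (Suc j)" by simp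
  finally show ?case .
qed simp

text \<open>With \<open>s choose t\<close> read as \<open>s choose (s - t)\<close>, binomial and
  factorial combine to at most s ^ (s - t). Only s - t is left in the exponent, so a spreadness well
  above 3 s beats the size of the layer.\<close>

lemma minimal_intersecting_layer_bound':
  assumes T: "minimal_intersecting t \<T>" "finite \<T>" "\<And>T. T \<in> \<T> \<Longrightarrow> finite T \<and> card T \<le> s"
    and "t \<le> s"
  shows "real (card {T\<in>\<T>. card T = s}) \<le> (3 * real s) ^ (s - t)"
proof -
  have "real (card {T\<in>\<T>. card T = s}) \<le> real ((s choose t) * (s - t + 1) ^ (s - t))"
    using minimal_intersecting_layer_bound[OF assms] by (rule of_nat_mono)
  also have "\<dots> = real (s choose (s - t)) * real (s - t + 1) ^ (s - t)"
    using binomial_symmetric[OF assms(4)] by simp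
  also have "\<dots> \<le> real (s choose (s - t)) * (3 ^ (s - t) * fact (s - t))"
    by (intro mult_left_mono Suc_power_le_fact) auto
  also have "\<dots> = 3 ^ (s - t) * real ((s choose (s - t)) * fact (s - t))" by simp
  also have "\<dots> \<le> 3 ^ (s - t) * real (s ^ (s - t))"
    by (intro mult_left_mono of_nat_mono binomial_fact_pow) auto
  finally show ?thesis by (simp add: power_mult_distrib)
qed

lemma cover_bound:
  fixes \<A> :: "'a set set"
  assumes A: "finite \<A>" "\<And>X. X \<subseteq> \<Omega> \<Longrightarrow> real (card {A\<in>\<A>. X \<subseteq> A}) * r ^ card X \<le> a"
    and r: "r > 0" and W: "finite \<W>" "\<W> \<subseteq> Pow \<Omega>" "\<And>W. W \<in> \<W> \<Longrightarrow> card W = s"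
  shows "real (card {A\<in>\<A>. \<exists>W\<in>\<W>. W \<subseteq> A}) \<le> real (card \<W>) * (a / r ^ s)"
proof -
  have "{A\<in>\<A>. \<exists>W\<in>\<W>. W \<subseteq> A} = (\<Union>W\<in>\<W>. {A\<in>\<A>. W \<subseteq> A})" by auto
  then have "card {A\<in>\<A>. \<exists>W\<in>\<W>. W \<subseteq> A} \<le> (\<Sum>W\<in>\<W>. card {A\<in>\<A>. W \<subseteq> A})"
    using W(1) by (simp add: card_UN_le)
  then have "real (card {A\<in>\<A>. \<exists>W\<in>\<W>. W \<subseteq> A}) \<le> (\<Sum>W\<in>\<W>. real (card {A\<in>\<A>. W \<subseteq> A}))"
    by (simp flip: of_nat_sum)
  also have "\<dots> \<le> (\<Sum>W\<in>\<W>. a / r ^ s)"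
  proof (intro sum_mono)
    fix W assume "W \<in> \<W>"
    then show "real (card {A\<in>\<A>. W \<subseteq> A}) \<le> a / r ^ s"
      using A(2)[of W] W r by (auto simp: field_simps)
  qed
  finally show ?thesis by simp
qed

text \<open>Induction on the excess j of the set sizes over t. The top layer of a minimal generating
  family covers at most (1/2)^j / 4 of a / r^t, and these shares sum to the first summand. Once the
  lower layers share a t-set K, either K lies in the whole top layer, or some top set W does not
  contain K. Then every lower set contains K and a further point of W, so at most q sets of size t +
  1 do the covering; this is the summand q / r, paid once.\<close>

lemma intersecting_family_cover:
  fixes \<A> \<S> :: "'a set set"
  assumes fin: "finite \<Omega>" and A: "finite \<A>" "\<And>X. X \<subseteq> \<Omega> \<Longrightarrow> real (card {A\<in>\<A>. X \<subseteq> A}) * r ^ card X \<le> a"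
    and r: "24 * real q \<le> r" "r > 0"
    and S: "\<S> \<subseteq> Pow \<Omega>" "intersecting_family t \<S>" "\<And>A. A \<in> \<S> \<Longrightarrow> card A \<le> t + j" "t + j \<le> q"
  shows "(\<exists>T. card T = t \<and> (\<forall>A\<in>\<S>. T \<subseteq> A)) \<or>
    real (card {A\<in>\<A>. \<exists>S\<in>\<S>. S \<subseteq> A}) \<le> ((1 - (1 / 2) ^ j) / 4 + real q / r) * (a / r ^ t)"
  using S
proof (induction j arbitrary: \<S>)
  case 0
  show ?case
  proof (cases "\<S> = {}")
    case True
    have "0 \<le> a" using A(2)[of "{}"] by (simp add: order_trans[OF of_nat_0_le_iff])
    then show ?thesis using True r by simp
  next
    case False
    then obtain T where T: "T \<in> \<S>" by blast
    have *: "card U = t \<and> finite U" if "U \<in> \<S>" for U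
      using 0(3)[OF that] 0(2)[unfolded intersecting_family_def, rule_format, OF that that]
        finite_subset[OF _ fin, of U] 0(1) that by auto
    have "T \<subseteq> U" if "U \<in> \<S>" for U
    proof -
      have "t \<le> card (T \<inter> U)" using 0(2) T that unfolding intersecting_family_def by blast
      then have "T \<inter> U = T" using *[OF T] by (intro card_seteq) auto
      then show ?thesis by auto
    qed
    then show ?thesis using *[OF T] by blast
  qed
next
  case (Suc j)
  define s where "s = t + Suc j"
  have a0: "0 \<le> a" using A(2)[of "{}"] by (simp add: order_trans[OF of_nat_0_le_iff])
  define c where "c = a / r ^ t"
  have c0: "0 \<le> c" using a0 r by (simp add: c_def)
  obtain \<T> where T: "\<T> \<subseteq> Pow \<Omega>" "minimal_intersecting t \<T>" "\<And>T. T \<in> \<T> \<Longrightarrow> card T \<le> s"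
      "\<And>A. A \<in> \<S> \<Longrightarrow> \<exists>T\<in>\<T>. T \<subseteq> A"
    using minimal_intersecting_exists[OF fin Suc.prems(1-3)] by (auto simp: s_def)
  have finT: "finite \<T>" using T(1) fin by (meson finite_Pow_iff finite_subset)
  have finT': "finite T" if "T \<in> \<T>" for T using T(1) that by (intro finite_subset[OF _ fin]) auto
  have int: "t \<le> card (U \<inter> V)" if "U \<in> \<T>" "V \<in> \<T>" for U V
    using T(2) that unfolding minimal_intersecting_def intersecting_family_def by blast
  define \<W> where "\<W> = {T\<in>\<T>. card T = s}"
  define \<U> where "\<U> = \<T> - \<W>"
  let ?cov = "\<lambda>\<S>. {A\<in>\<A>. \<exists>S\<in>\<S>. S \<subseteq> A}"
  have cov_mono: "real (card (?cov \<S>)) \<le> real (card (?cov \<W>)) + real (card (?cov \<U>))"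
  proof -
    have "?cov \<S> \<subseteq> ?cov \<W> \<union> ?cov \<U>"
    proof
      fix A assume "A \<in> ?cov \<S>"
      then obtain S where S: "A \<in> \<A>" "S \<subseteq> A" "S \<in> \<S>" by blast
      obtain T where "T \<in> \<T>" "T \<subseteq> S" using T(4)[OF S(3)] by blast
      then have "T \<subseteq> A" "T \<in> \<W> \<or> T \<in> \<U>" using S by (auto simp: \<U>_def)
      then show "A \<in> ?cov \<W> \<union> ?cov \<U>" using S(1) by blast
    qed
    then have "card (?cov \<S>) \<le> card (?cov \<W> \<union> ?cov \<U>)" using A(1) by (intro card_mono) auto
    also have "\<dots> \<le> card (?cov \<W>) + card (?cov \<U>)" by (rule card_Un_le)
    finally show ?thesis by simp
  qed
  have covW: "real (card (?cov \<W>)) \<le> (1 / 2) ^ Suc j / 4 * c"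
  proof -
    have "real (card (?cov \<W>)) \<le> real (card \<W>) * (a / r ^ s)"
      by (rule cover_bound[OF A r(2)]) (use finT T in \<open>auto simp: \<W>_def\<close>)
    also have "\<dots> \<le> (3 * real s) ^ (s - t) * (a / r ^ s)"
      unfolding \<W>_def using T(2,3) finT finT' a0 r
      by (intro mult_right_mono minimal_intersecting_layer_bound') (auto simp: s_def)
    also have "\<dots> = (3 * real s / r) ^ Suc j * c"
      using r by (simp add: s_def c_def power_add power_divide)
    \<comment> \<open>3 s <= 3 q <= r / 8. Of each factor 1/8 the part 1/2 feeds the geometric sum,
      and a single factor 1/4 is kept.\<close>
    also have "\<dots> \<le> (1 / 8) ^ Suc j * c"
    proof (intro mult_right_mono power_mono c0)
      have "real s \<le> real q" using Suc.prems(4) by (simp add: s_def)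
      then have "24 * real s \<le> r" using r(1) by linarith
      then show "3 * real s / r \<le> 1 / 8" using r(2) by (simp add: field_simps)
    qed (use r in auto)
    also have "(1 / 8 :: real) ^ Suc j = (1 / 4) ^ Suc j * (1 / 2) ^ Suc j"
      by (simp flip: power_mult_distrib)
    also have "\<dots> * c \<le> 1 / 4 * (1 / 2) ^ Suc j * c"
      using c0 by (intro mult_right_mono) (auto simp: power_le_one)
    finally show ?thesis by simp
  qed
  have U: "\<U> \<subseteq> Pow \<Omega>" "intersecting_family t \<U>" "\<And>A. A \<in> \<U> \<Longrightarrow> card A \<le> t + j" "t + j \<le> q"
  proof -
    show "\<U> \<subseteq> Pow \<Omega>" using T(1) by (auto simp: \<U>_def)
    show "intersecting_family t \<U>" using int by (auto simp: \<U>_def intersecting_family_def)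
    show "t + j \<le> q" using Suc.prems(4) by simp
    fix A assume "A \<in> \<U>"
    then have "card A \<le> s" "card A \<noteq> s" using T(3) by (auto simp: \<U>_def \<W>_def)
    then show "card A \<le> t + j" by (simp add: s_def)
  qed
  from Suc.IH[OF U] show ?case
  proof
    assume le: "real (card (?cov \<U>)) \<le> ((1 - (1 / 2) ^ j) / 4 + real q / r) * (a / r ^ t)"
    have "real (card (?cov \<S>)) \<le> (1 / 2) ^ Suc j / 4 * c + ((1 - (1 / 2) ^ j) / 4 + real q / r) * c"
      using cov_mono covW le unfolding c_def by linarith
    also have "\<dots> = ((1 - (1 / 2) ^ Suc j) / 4 + real q / r) * c"
      by (simp add: field_simps)
    finally show ?thesis unfolding c_def by blast
  next
    assume "\<exists>T. card T = t \<and> (\<forall>A\<in>\<U>. T \<subseteq> A)"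
    then obtain K where K: "card K = t" "\<And>A. A \<in> \<U> \<Longrightarrow> K \<subseteq> A" by blast
    show ?thesis
    proof (cases "\<forall>W\<in>\<W>. K \<subseteq> W")
      case True
      then have "K \<subseteq> T" if "T \<in> \<T>" for T using K(2) that by (auto simp: \<U>_def)
      then show ?thesis using K(1) T(4) by blast
    next
      case False
      then obtain W where W: "W \<in> \<W>" "\<not> K \<subseteq> W" by blast
      have WT: "W \<in> \<T>" "card W = s" using W by (auto simp: \<W>_def)
      have covU: "real (card (?cov \<U>)) \<le> real q / r * c"
      proof (cases "\<U> = {}")
        case True
        then show ?thesis using c0 r by simp
      next
        case False
        then obtain U0 where U0: "U0 \<in> \<U>" by blast
        have finK: "finite K" "K \<subseteq> \<Omega>"
          using K(2)[OF U0] U(1) U0 finite_subset[OF _ fin, of K] by auto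
        define \<Y> where "\<Y> = (\<lambda>y. insert y K) ` (W - K)"
        have finW: "finite W" using finT' WT by simp
        have "?cov \<U> \<subseteq> ?cov \<Y>"
        proof
          fix A assume "A \<in> ?cov \<U>"
          then obtain V where V: "V \<in> \<U>" "V \<subseteq> A" "A \<in> \<A>" by blast
          \<comment> \<open>As K is not inside W, an intersection within K would be a proper part of
            K and have fewer than t elements.\<close>
          have "\<not> V \<inter> W \<subseteq> K"
          proof
            assume "V \<inter> W \<subseteq> K"
            then have "V \<inter> W \<subset> K" using W(2) by blast
            then have "card (V \<inter> W) < t" using psubset_card_mono[OF finK(1)] K(1) by blast
            then show False using int[of V W] V WT by (auto simp: \<U>_def)
          qed
          then obtain y where "y \<in> V" "y \<in> W - K" by blast
          then have "insert y K \<in> \<Y>" "insert y K \<subseteq> A" using K(2)[OF V(1)] V by (auto simp: \<Y>_def)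
          then show "A \<in> ?cov \<Y>" using V by blast
        qed
        then have "real (card (?cov \<U>)) \<le> real (card (?cov \<Y>))" using A(1) by (simp add: card_mono)
        also have "\<dots> \<le> real (card \<Y>) * (a / r ^ Suc t)"
        proof (rule cover_bound[OF A r(2)])
          show "finite \<Y>" using finW by (simp add: \<Y>_def)
          show "\<Y> \<subseteq> Pow \<Omega>" using finK T(1) WT by (auto simp: \<Y>_def)
          show "card Z = Suc t" if "Z \<in> \<Y>" for Z using that finK K(1) by (auto simp: \<Y>_def)
        qed
        also have "\<dots> \<le> real q * (a / r ^ Suc t)"
        proof (intro mult_right_mono of_nat_mono)
          have "card \<Y> \<le> card (W - K)" unfolding \<Y>_def using finW by (intro card_image_le) auto
          also have "\<dots> \<le> card W" using finW by (intro card_mono) auto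
          finally show "card \<Y> \<le> q" using WT Suc.prems(4) by (simp add: s_def)
        qed (use a0 r in auto)
        also have "\<dots> = real q / r * c" by (simp add: c_def)
        finally show ?thesis .
      qed
      \<comment> \<open>With x = (1/2)^(j+1) <= 1/2 one has x <= 1 - x, so the top layer alone fits
        under the first summand.\<close>
      have "(1 / 2) ^ Suc j \<le> (1 / 2 :: real)" by (simp add: power_le_one)
      then have "(1 / 2) ^ Suc j / 4 * c \<le> (1 - (1 / 2) ^ Suc j) / 4 * c"
        using c0 by (intro mult_right_mono) (auto simp: field_simps)
      then have "real (card (?cov \<S>)) \<le> ((1 - (1 / 2) ^ Suc j) / 4 + real q / r) * c"
        using cov_mono covW covU unfolding distrib_right by linarith
      then show ?thesis unfolding c_def by blast
    qed
  qed
qed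

section \<open>Intersecting families of spanning trees\<close>

lemma card_trees_over_forest:
  assumes X: "acyclic_graph X" "X \<subseteq> Kn_edges n" and n: "n \<ge> 2"
  shows "real (card (trees_over n X)) * real n ^ card X = real (weight n X) * real n ^ (n - 2)"
proof -
  have "real (card (trees_over n X)) * real n ^ card X * real n ^ 2
      = real (weight n X) * (real n ^ card (components n X) * real n ^ card X)"
    using card_trees_over[OF X] n by (simp add: mult_ac)
  also have "real n ^ card (components n X) * real n ^ card X = real n ^ (n - 2) * real n ^ 2"
  proof -
    have "card (components n X) + card X = (n - 2) + 2" using card_forest[OF X] n by simp
    then show ?thesis by (simp only: power_add[symmetric])
  qed
  finally have "(real (card (trees_over n X)) * real n ^ card X) * real n ^ 2
      = (real (weight n X) * real n ^ (n - 2)) * real n ^ 2" by (simp only: mult_ac)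
  then show ?thesis using n by simp
qed

lemma card_trees_over_le:
  assumes "X \<subseteq> Kn_edges n" "n \<ge> 2"
  shows "real (card (trees_over n X)) * (real n / 2) ^ card X \<le> real n ^ (n - 2)"
proof (cases "acyclic_graph X")
  case True
  have "real (weight n X) \<le> real (2 ^ card X)"
    using weight_bound[OF True assms(1)] by (intro of_nat_mono) blast
  then have "real (weight n X) * real n ^ (n - 2) \<le> 2 ^ card X * real n ^ (n - 2)"
    by (intro mult_right_mono) auto
  then show ?thesis
    using card_trees_over_forest[OF True assms] by (simp add: power_divide field_simps)
next
  case False
  then show ?thesis by (simp add: trees_over_empty_iff)
qed

text \<open>An edge disjoint from all earlier ones has isolated ends when it is added, so it closes
  no cycle.\<close>

lemma matching_acyclic:
  assumes "X \<subseteq> Kn_edges n" "pairwise disjnt X"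
  shows "acyclic_graph X"
proof -
  have "finite X" using finite_subset[OF assms(1) finite_Kn_edges] .
  then show ?thesis using assms
  proof (induction X rule: finite_induct)
    case empty
    then show ?case by (simp add: acyclic_graph_def)
  next
    case (insert e X)
    have "e \<in> Kn_edges n" using insert.prems by simp
    then obtain u v where e: "e = {u, v}" "u \<noteq> v" "u \<in> {1..n}" "v \<in> {1..n}"
      by (rule Kn_edgesE)
    have X: "acyclic_graph X" "X \<subseteq> Kn_edges n"
      using insert by (auto simp: pairwise_insert)
    have "\<forall>f\<in>X. u \<notin> f"
    proof (intro ballI notI)
      fix f assume f: "f \<in> X" "u \<in> f"
      then have "e \<noteq> f" using insert.hyps by auto
      then have "disjnt e f" using pairwiseD[OF insert.prems(2), of e f] f by simp
      then show False using e f by (auto simp: disjnt_def)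
    qed
    then have "card (component X u) = 1" using singleton_component_iff[OF X(2) e(3)] by simp
    then obtain w where "component X u = {w}" by (rule card_1_singletonE)
    then have "v \<notin> component X u" using self_in_component[of u X] e(2) by auto
    then have "(u, v) \<notin> (adj X)\<^sup>*" by (simp only: mem_component not_False_eq_True)
    then show ?case using acyclic_graph_insert[OF X(1) e(2)] e(1) by simp
  qed
qed

lemma card_trees_over_matching:
  assumes "X \<subseteq> Kn_edges n" "n \<ge> 2" "pairwise disjnt X"
  shows "real (card (trees_over n X)) * real n ^ card X = 2 ^ card X * real n ^ (n - 2)"
proof -
  note ac = matching_acyclic[OF assms(1,3)]
  have "weight n X = 2 ^ card X" using weight_bound[OF ac assms(1)] assms(3) by blast
  then show ?thesis using card_trees_over_forest[OF ac assms(1,2)] by simp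
qed

text \<open>Weights are integers, so falling short of 2 ^ \<open>card X\<close> means losing at
  least 1. The resulting loss of n ^ (n - 2) in the scaled count outweighs the uncovered part of F,
  which is at most a quarter of it.\<close>

lemma card_trees_over_not_matching:
  assumes "X \<subseteq> Kn_edges n" "n \<ge> 2" "\<not> pairwise disjnt X"
  shows "real (card (trees_over n X)) * real n ^ card X \<le> (2 ^ card X - 1) * real n ^ (n - 2)"
proof (cases "acyclic_graph X")
  case True
  have "weight n X < 2 ^ card X" using weight_bound[OF True assms(1)] assms(3) by force
  then have "real (weight n X + 1) \<le> real (2 ^ card X)" by (intro of_nat_mono) simp
  then have "real (weight n X) * real n ^ (n - 2) \<le> (2 ^ card X - 1) * real n ^ (n - 2)"
    by (intro mult_right_mono) auto
  then show ?thesis using card_trees_over_forest[OF True assms(1,2)] by simp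
next
  case False
  then show ?thesis by (simp add: trees_over_empty_iff)
qed

section \<open>Trees over a matching that meet a given tree in few edges\<close>

lemma acyclic_no_four_cycle:
  assumes "acyclic_graph X" "a \<noteq> b" "c \<noteq> d" "a \<noteq> c" "a \<noteq> d" "b \<noteq> c" "b \<noteq> d"
    and "{a, c} \<in> X" "{a, d} \<in> X" "{b, c} \<in> X" "{b, d} \<in> X"
  shows False
proof -
  let ?Y = "X - {{a, c}}"
  have "(a, d) \<in> adj ?Y" "(d, b) \<in> adj ?Y" "(b, c) \<in> adj ?Y"
    using assms by (auto simp: adj_def doubleton_eq_iff insert_commute)
  then have "(a, c) \<in> (adj ?Y)\<^sup>*" by (meson r_into_rtrancl rtrancl_trans)
  then show False using assms unfolding acyclic_graph_def by blast
qed

text \<open>The complement of a spanning tree is disconnected only if the tree is a star. In that case one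
  edge of the star restores connectivity, which is where t > 1 is needed.\<close>

lemma connected_supergraph_of_complement:
  assumes F: "spanning_tree n F" and T: "T \<subseteq> Kn_edges n" "\<not> T \<subseteq> F" and n: "n \<ge> 2" and t: "1 < card T"
  obtains G where "G \<subseteq> Kn_edges n" "connected_on {1..n} G" "(Kn_edges n - F) \<union> T \<subseteq> G" "card (G \<inter> F) < card T"
proof -
  define G where "G = (Kn_edges n - F) \<union> T"
  have finT: "finite T" using finite_subset[OF T(1) finite_Kn_edges] .
  have G: "G \<subseteq> Kn_edges n" using T by (auto simp: G_def)
  show thesis
  proof (cases "connected_on {1..n} G")
    case True
    have "G \<inter> F \<subset> T" using T by (auto simp: G_def)
    then have "card (G \<inter> F) < card T" using finT by (rule psubset_card_mono[rotated])
    then show thesis using True G by (intro that[of G]) (auto simp: G_def)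
  next
    case False
    then obtain u v where uv: "u \<in> {1..n}" "v \<in> {1..n}" "(u, v) \<notin> (adj G)\<^sup>*"
      by (auto simp: connected_on_def)
    define P where "P = component G u"
    have P: "P \<subseteq> {1..n}" "u \<in> P" "v \<notin> P"
      using component_subset[OF G uv(1)] uv(3) by (auto simp: P_def mem_component)
    have cross: "{x, y} \<in> F - T" if "x \<in> P" "y \<in> {1..n} - P" for x y
    proof (rule ccontr)
      assume "{x, y} \<notin> F - T"
      moreover have "x \<noteq> y" using that by auto
      ultimately have "(x, y) \<in> adj G" using that P Kn_edgesI[of x y n] by (auto simp: G_def adj_def)
      moreover have "(u, x) \<in> (adj G)\<^sup>*" using that by (simp add: P_def mem_component)
      ultimately have "(u, y) \<in> (adj G)\<^sup>*" by (rule rtrancl_into_rtrancl[rotated])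
      then show False using that by (simp add: P_def mem_component)
    qed
    \<comment> \<open>With two vertices on each side of the cut, the four crossing edges, all in F,
      would form a cycle in the tree.\<close>
    have "(\<exists>w. P = {w}) \<or> (\<exists>w. {1..n} - P = {w})"
    proof (rule ccontr)
      assume "\<not> ?thesis"
      then obtain a c where ac: "a \<in> P" "a \<noteq> u" "c \<in> {1..n} - P" "c \<noteq> v"
        using P uv by blast
      have "{u, v} \<in> F" "{u, c} \<in> F" "{a, v} \<in> F" "{a, c} \<in> F"
        using cross ac uv P by auto
      then show False
        using acyclic_no_four_cycle[of F u a v c] F ac P uv by (auto simp: spanning_tree_def)
    qed
    then obtain w where w: "w \<in> {1..n}" "\<And>x. x \<in> {1..n} \<Longrightarrow> x \<noteq> w \<Longrightarrow> {w, x} \<in> F - T"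
    proof (elim disjE exE)
      fix w assume w: "P = {w}"
      have "{w, x} \<in> F - T" if "x \<in> {1..n}" "x \<noteq> w" for x
        by (rule cross) (use w that in blast)+
      moreover have "w \<in> {1..n}" using w P(1) by blast
      ultimately show thesis using that by blast
    next
      fix w assume w: "{1..n} - P = {w}"
      have "{w, x} \<in> F - T" if "x \<in> {1..n}" "x \<noteq> w" for x
        unfolding insert_commute[of w x] by (rule cross) (use w that in blast)+
      moreover have "w \<in> {1..n}" using w by blast
      ultimately show thesis using that by blast
    qed
    \<comment> \<open>The n - 1 edges at w exhaust the tree, and all of them avoid T. Adding one of
      them to \<open>G\<close> thus creates a single common edge with F, fewer than
      \<open>card T\<close>.\<close>
    have star: "(\<lambda>x. {w, x}) ` ({1..n} - {w}) = F"
    proof (rule card_subset_eq)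
      show "finite F" using spanning_tree_finite[OF F] .
      show "(\<lambda>x. {w, x}) ` ({1..n} - {w}) \<subseteq> F" using w(2) by blast
      have "inj_on (\<lambda>x. {w, x}) ({1..n} - {w})" by (auto simp: inj_on_def doubleton_eq_iff)
      then show "card ((\<lambda>x. {w, x}) ` ({1..n} - {w})) = card F"
        using card_spanning_tree[OF F] n w(1) by (simp add: card_image)
    qed
    have TF: "T \<inter> F = {}" using star w(2) by blast
    have "{1..n} - {w} \<noteq> {}"
    proof
      assume "{1..n} - {w} = {}"
      then have "{1..n} \<subseteq> {w}" by blast
      then have "card {1..n} \<le> card {w}" by (intro card_mono) auto
      then show False using n by simp
    qed
    then obtain x where x: "x \<in> {1..n}" "x \<noteq> w" by blast
    define G' where "G' = insert {w, x} G"
    have sub: "G' \<subseteq> Kn_edges n" using G Kn_edgesI[of w x n] x w(1) by (auto simp: G'_def)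
    \<comment> \<open>x is joined to w by the new edge and to every other vertex by an edge outside
      the star.\<close>
    have "(x, y) \<in> (adj G')\<^sup>*" if y: "y \<in> {1..n}" for y
    proof (cases "y = x")
      case False
      have "{x, y} \<in> G'"
      proof (cases "y = w")
        case True
        then show ?thesis by (auto simp: G'_def insert_commute)
      next
        case yw: False
        have "w \<in> e" if "e \<in> F" for e using that unfolding star[symmetric] by blast
        then have "{x, y} \<notin> F" using x(2) yw by blast
        then show ?thesis using Kn_edgesI[of x y n] x y False by (auto simp: G'_def G_def)
      qed
      then show ?thesis using False by (auto simp: adj_def)
    qed simp
    then have conn: "connected_on {1..n} G'"
      unfolding connected_on_def by (intro ballI) (rule rtrancl_trans[OF reach_sym])
    have "G' \<inter> F \<subseteq> {{w, x}}" using TF by (auto simp: G'_def G_def)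
    then have "card (G' \<inter> F) \<le> card {{w, x}}" by (intro card_mono) auto
    then have "card (G' \<inter> F) < card T" using t by simp
    then show thesis using conn sub by (intro that[of G']) (auto simp: G'_def G_def)
  qed
qed

text \<open>Each step adds one point or none, the latter encoded by \<open>None\<close>. For a tree,
  \<open>card S\<close> + 1 = n, whence the bound n ^ 3 in the application.\<close>

lemma card_small_subsets_le:
  fixes S :: "'a set"
  assumes "finite S"
  shows "card {X. X \<subseteq> S \<and> card X \<le> k} \<le> (card S + 1) ^ k"
proof (induction k)
  case 0
  have "X = {}" if "X \<subseteq> S" "card X \<le> 0" for X
    using finite_subset[OF that(1) assms] that(2) by simp
  then have "{X. X \<subseteq> S \<and> card X \<le> 0} \<subseteq> {{}}" by blast
  then have "card {X. X \<subseteq> S \<and> card X \<le> 0} \<le> card {{} :: 'a set}" by (intro card_mono) auto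
  then show ?case by simp
next
  case (Suc k)
  let ?D = "{X. X \<subseteq> S \<and> card X \<le> k} \<times> insert None (Some ` S)"
  let ?f = "\<lambda>(X, z). case z of None \<Rightarrow> X | Some x \<Rightarrow> insert x X"
  have "finite {X. X \<subseteq> S \<and> card X \<le> k}"
    by (rule finite_subset[of _ "Pow S"]) (use assms in blast, simp add: assms)
  then have finD: "finite ?D" using assms by blast
  have "{X. X \<subseteq> S \<and> card X \<le> Suc k} \<subseteq> ?f ` ?D"
  proof
    fix X assume X: "X \<in> {X. X \<subseteq> S \<and> card X \<le> Suc k}"
    show "X \<in> ?f ` ?D"
    proof (cases "X = {}")
      case True
      then show ?thesis by (intro image_eqI[of _ _ "({}, None)"]) auto
    next
      case False
      then obtain x where x: "x \<in> X" by blast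
      have "finite X" using X assms finite_subset by auto
      moreover have "card X \<le> Suc k" using X by blast
      ultimately have "card (X - {x}) \<le> k" using x by (simp add: card_Diff_singleton)
      then show ?thesis
        using X x by (intro image_eqI[of _ _ "(X - {x}, Some x)"]) auto
    qed
  qed
  then have "card {X. X \<subseteq> S \<and> card X \<le> Suc k} \<le> card (?f ` ?D)"
    using finD by (intro card_mono finite_imageI)
  also have "\<dots> \<le> card ?D" using finD by (rule card_image_le)
  also have "\<dots> = card {X. X \<subseteq> S \<and> card X \<le> k} * (card S + 1)"
    using assms by (simp add: card_cartesian_product card_image)
  also have "\<dots> \<le> (card S + 1) ^ k * (card S + 1)" using Suc by (intro mult_right_mono) auto
  finally show ?case by (simp add: mult.commute)
qed

text \<open>On average a tree containing T has at most two further edges in F, so at least half of these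
  trees have at most three. Exchanging these edges for edges outside F turns such a tree into one
  meeting F in few edges, and each of the latter arises in at most n^6 ways.\<close>

lemma card_few_intersections:
  assumes F: "spanning_tree n F" and T: "T \<subseteq> Kn_edges n" "pairwise disjnt T" "\<not> T \<subseteq> F"
    and n: "n \<ge> 2" and t: "1 < card T"
  shows "real (card (trees_over n T))
      \<le> 2 * real n ^ 6 * real (card {A\<in>trees_over n T. card (A \<inter> F) < card T})"
proof -
  define B where "B = {A\<in>trees_over n T. card (A \<inter> F) < card T}"
  define D where "D = {A\<in>trees_over n T. card (A \<inter> (F - T)) \<le> 3}"
  define N where "N = real (card (trees_over n T))"
  have finF: "finite F" using spanning_tree_finite[OF F] .
  have FK: "F \<subseteq> Kn_edges n" using F by (simp add: spanning_tree_def)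
  have cardF: "card F = n - 1" using card_spanning_tree[OF F] n by simp
  have finT: "finite T" using finite_subset[OF T(1) finite_Kn_edges] .
  have half: "N \<le> 2 * real (card D)"
  proof -
    \<comment> \<open>Markov's inequality: trees outside \<open>D\<close> have at least four edges
      in F - T, while the average is at most two, as each of fewer than n edges lies in at most a 2
      / n share of the trees.\<close>
    have "4 * real (card (trees_over n T - D)) = (\<Sum>A\<in>trees_over n T - D. 4)" by simp
    also have "\<dots> \<le> (\<Sum>A\<in>trees_over n T - D. real (card (A \<inter> (F - T))))"
      by (intro sum_mono) (auto simp: D_def)
    also have "\<dots> \<le> (\<Sum>A\<in>trees_over n T. real (card (A \<inter> (F - T))))"
      by (intro sum_mono2) auto
    also have "\<dots> = (\<Sum>A\<in>trees_over n T. \<Sum>e\<in>{e\<in>F - T. e \<in> A}. 1)"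
      by (auto intro!: sum.cong arg_cong[where f = card])
    also have "\<dots> = (\<Sum>e\<in>F - T. \<Sum>A\<in>{A\<in>trees_over n T. e \<in> A}. 1)"
      by (rule sum.swap_restrict) (use finF in auto)
    also have "\<dots> = (\<Sum>e\<in>F - T. real (card (trees_over n (insert e T))))"
      by (auto intro!: sum.cong arg_cong[where f = card] simp: trees_over_def)
    also have "\<dots> \<le> (\<Sum>e\<in>F - T. 2 * N / real n)"
    proof (intro sum_mono)
      fix e assume e: "e \<in> F - T"
      have "real (card (trees_over n (insert e T))) * (real n / 2) ^ card (insert e T)
          \<le> real n ^ (n - 2)"
        using e FK T by (intro card_trees_over_le n) auto
      also have "\<dots> = N * (real n / 2) ^ card T"
        using card_trees_over_matching[OF T(1) n T(2)] by (simp add: N_def power_divide field_simps)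
      finally have "real (card (trees_over n (insert e T))) * (real n / 2) * (real n / 2) ^ card T
          \<le> N * (real n / 2) ^ card T"
        using e finT by (simp add: mult_ac)
      then have "real (card (trees_over n (insert e T))) * (real n / 2) \<le> N"
        using n by (simp add: mult_le_cancel_right)
      then show "real (card (trees_over n (insert e T))) \<le> 2 * N / real n"
        using n by (simp add: field_simps)
    qed
    also have "\<dots> = real (card (F - T)) * (2 * N / real n)" by simp
    also have "\<dots> \<le> real n * (2 * N / real n)"
    proof (intro mult_right_mono of_nat_mono)
      have "card (F - T) \<le> card F" using finF by (intro card_mono) auto
      then show "card (F - T) \<le> n" using cardF by simp
    qed (simp add: N_def)
    also have "\<dots> = 2 * N" using n by simp
    finally have "4 * real (card (trees_over n T - D)) \<le> 2 * N" .
    moreover have "card (trees_over n T - D) = card (trees_over n T) - card D" "card D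
        \<le> card (trees_over n T)"
      by (auto intro!: card_Diff_subset card_mono simp: D_def)
    ultimately show ?thesis by (simp add: N_def of_nat_diff)
  qed
  obtain G where G: "G \<subseteq> Kn_edges n" "connected_on {1..n} G" "(Kn_edges n - F) \<union> T \<subseteq> G" "card (G \<inter> F) < card T"
    using connected_supergraph_of_complement[OF F T(1,3) n t] .
  have "\<forall>A\<in>D. \<exists>A'. A' \<in> B \<and> A - A' \<subseteq> F \<and> card (A - A') \<le> 3 \<and> card (A' - A) \<le> 3"
  proof
    fix A assume A: "A \<in> D"
    have tree: "spanning_tree n A" "T \<subseteq> A" "card (A \<inter> (F - T)) \<le> 3"
      using A by (auto simp: D_def trees_over_def)
    have AK: "A \<subseteq> Kn_edges n" using tree by (simp add: spanning_tree_def)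
    have finA: "finite A" using spanning_tree_finite[OF tree(1)] .
    \<comment> \<open>Dropping the at most three offending edges leaves a forest inside
      \<open>G\<close>. Completing it inside \<open>G\<close> keeps the intersection with F within G
      \<inter> F, which has fewer than \<open>card T\<close> elements.\<close>
    define A0 where "A0 = A - (F - T)"
    have "acyclic_graph A0"
      using tree(1) acyclic_graph_mono[of A A0] by (auto simp: A0_def spanning_tree_def)
    moreover have "A0 \<subseteq> Kn_edges n" using AK by (auto simp: A0_def)
    ultimately obtain A' where A': "spanning_tree n A'" "A0 \<subseteq> A'" "A' \<subseteq> A0 \<union> G"
      using G(1,2) by (rule spanning_tree_extension)
    have "A0 \<subseteq> G" using AK G(3) by (auto simp: A0_def)
    then have "A' \<inter> F \<subseteq> G \<inter> F" using A'(3) by auto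
    then have "card (A' \<inter> F) \<le> card (G \<inter> F)" using finF by (intro card_mono) auto
    then have "card (A' \<inter> F) < card T" using G(4) by simp
    moreover have "T \<subseteq> A'" using A'(2) tree(2) by (auto simp: A0_def)
    ultimately have B: "A' \<in> B" using A'(1) by (simp add: B_def trees_over_def)
    have diff: "A - A' \<subseteq> A \<inter> (F - T)" using A'(2) by (auto simp: A0_def)
    then have "card (A - A') \<le> card (A \<inter> (F - T))" using finF by (intro card_mono) auto
    then have le: "card (A - A') \<le> 3" using tree(3) by simp
    \<comment> \<open>Both trees have n - 1 edges, so as many edges come in as go out.\<close>
    have "card (A' - A) = card (A - A')"
    proof -
      have "card A = card A'" using card_spanning_tree[OF tree(1)] card_spanning_tree[OF A'(1)] n by simp
      then show ?thesis
        using card_Int_Diff[OF finA, of A'] card_Int_Diff[OF spanning_tree_finite[OF A'(1)], of A]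
        by (simp add: Int_commute)
    qed
    then show "\<exists>A'. A' \<in> B \<and> A - A' \<subseteq> F \<and> card (A - A') \<le> 3 \<and> card (A' - A) \<le> 3"
      using B le diff by auto
  qed
  from bchoice[OF this] obtain \<phi> where phi:
    "\<And>A. A \<in> D \<Longrightarrow> \<phi> A \<in> B \<and> A - \<phi> A \<subseteq> F \<and> card (A - \<phi> A) \<le> 3 \<and> card (\<phi> A - A) \<le> 3"
    by blast
  define small where "small S = {X :: nat set set. X \<subseteq> S \<and> card X \<le> 3}" for S
  have small: "finite (small S)" "card (small S) \<le> n ^ 3" if "spanning_tree n S" for S
  proof -
    show "finite (small S)" using spanning_tree_finite[OF that] by (simp add: small_def)
    show "card (small S) \<le> n ^ 3"
      using card_small_subsets_le[OF spanning_tree_finite[OF that], of 3] card_spanning_tree[OF that] n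
      by (simp add: small_def)
  qed
  have Btree: "spanning_tree n A" if "A \<in> B" for A using that by (auto simp: B_def trees_over_def)
  have finB: "finite B" by (simp add: B_def)
  define C where "C = Sigma B (\<lambda>A'. small A' \<times> small F)"
  have finC: "finite C" unfolding C_def using finB small Btree F by auto
  \<comment> \<open>A is recovered from its image by deleting the edges that came in and restoring
    those that went out. The latter lie in F, so both exchanged sets are small subsets of known
    trees.\<close>
  let ?code = "\<lambda>A. (\<phi> A, \<phi> A - A, A - \<phi> A)"
  have "inj_on ?code D"
  proof (rule inj_onI)
    fix A A' assume "A \<in> D" "A' \<in> D" and eq: "?code A = ?code A'"
    have dec: "A = (\<phi> A - (\<phi> A - A)) \<union> (A - \<phi> A)" for A by blast
    have "A = (\<phi> A - (\<phi> A - A)) \<union> (A - \<phi> A)" by (rule dec)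
    also have "\<dots> = (\<phi> A' - (\<phi> A' - A')) \<union> (A' - \<phi> A')"
      using eq unfolding prod.inject by (elim conjE) (simp only:)
    also have "\<dots> = A'" by (rule dec[symmetric])
    finally show "A = A'" .
  qed
  moreover have "?code ` D \<subseteq> C" using phi by (auto simp: C_def small_def)
  ultimately have "card D \<le> card C" using finC by (rule card_inj_on_le)
  also have "card C = (\<Sum>A'\<in>B. card (small A' \<times> small F))"
    unfolding C_def using finB small Btree F by (intro card_SigmaI) auto
  also have "\<dots> \<le> (\<Sum>A'\<in>B. n ^ 3 * n ^ 3)"
    unfolding card_cartesian_product using small Btree F by (intro sum_mono mult_mono) simp_all
  also have "\<dots> = n ^ 6 * card B" by (simp flip: power_add)
  finally have "real (card D) \<le> real n ^ 6 * real (card B)"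
    by (metis of_nat_le_iff of_nat_mult of_nat_power)
  then show ?thesis using half by (simp add: N_def B_def)
qed

section \<open>Parameters and the final case analysis\<close>

lemma spanning_tree_parameters:
  fixes n t :: nat
  assumes n: "n \<ge> 2 ^ 19" and t: "1 < t" "real t \<le> real n / (4032 * log 2 (real n))"
  obtains q where "real n ^ (t + 7) < 2 ^ (q + 1)" "896 * real q \<le> real n" "t \<le> q"
proof -
  define L where "L = log 2 (real n)"
  have n19: "real n \<ge> 2 ^ 19" using n by (metis of_nat_le_iff of_nat_numeral of_nat_power)
  then have n0: "real n > 0" by (rule less_le_trans[rotated]) simp
  have "log 2 (2 ^ 19) \<le> L" unfolding L_def using n19 n0 by (subst log_le_cancel_iff) auto
  then have L: "L \<ge> 19" using log_pow_cancel[of 2 19] by simp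
  have tL: "4032 * (real t * L) \<le> real n"
    using t(2) L by (simp add: L_def[symmetric] field_simps)
  \<comment> \<open>Rounding down still leaves q + 1 > (t + 7) L, hence the strict inequality for 2
    ^ (q + 1).\<close>
  define q where "q = nat \<lfloor>real (t + 7) * L\<rfloor>"
  have pos: "0 \<le> real (t + 7) * L" using L by simp
  have q_le: "real q \<le> real (t + 7) * L" unfolding q_def using pos by (simp add: of_nat_nat)
  have q_gt: "real (t + 7) * L < real (q + 1)" unfolding q_def using pos
      by (simp add: of_nat_nat) linarith
  \<comment> \<open>t + 7 <= 9/2 t holds from t = 2 on, where it is an equality.\<close>
  have "real (t + 7) * L \<le> (9 / 2 * real t) * L"
    using t(1) L by (intro mult_right_mono) auto
  then have "real q \<le> (9 / 2 * real t) * L" using q_le by (rule order_trans[rotated])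
  then have "real q \<le> 9 / 2 * (real t * L)" by (simp only: mult.assoc)
  then have "896 * real q \<le> real n" using tL by linarith
  moreover have "t \<le> q"
  proof -
    have "real (t + 7) * 1 \<le> real (t + 7) * L" using L by (intro mult_left_mono) auto
    also have "\<dots> < real (q + 1)" by (rule q_gt)
    finally show ?thesis by simp
  qed
  moreover have "real n ^ (t + 7) < 2 ^ (q + 1)"
  proof -
    have "real n ^ (t + 7) = (2 powr L) ^ (t + 7)" using n0 by (simp add: L_def)
    also have "\<dots> = 2 powr (real (t + 7) * L)" by (simp add: powr_power mult.commute)
    also have "\<dots> < 2 powr real (q + 1)" using q_gt by (intro powr_less_mono) auto
    also have "\<dots> = 2 ^ (q + 1)" by (rule powr_realpow) simp
    finally show ?thesis .
  qed
  ultimately show thesis using that by blast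
qed

text \<open>Both the bound and its equality case follow from this dichotomy. Counts are scaled by n
  ^ t so that t does not enter a natural subtraction.\<close>

lemma t_intersecting_spanning_trees:
  fixes n t :: nat and F :: "nat set set set"
  assumes n: "n \<ge> 2 ^ 19"
    and t: "1 < t" "real t \<le> real n / (4032 * log 2 (real n))"
    and F: "\<forall>T\<in>F. spanning_tree n T"
    and int: "t_intersecting t F"
  shows "real (card F) * real n ^ t < 2 ^ t * real n ^ (n - 2) \<or>
    (\<exists>M. M \<subseteq> Kn_edges n \<and> card M = t \<and> pairwise disjnt M \<and> F = trees_over n M)"
proof -
  obtain q where q: "real n ^ (t + 7) < 2 ^ (q + 1)" "896 * real q \<le> real n" "t \<le> q"
    using spanning_tree_parameters[OF n t] .
  define a where "a = real n ^ (n - 2)"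
  define r where "r = real n / 2"
  define \<Omega> where "\<Omega> = Kn_edges n"
  have n19: "real n \<ge> 2 ^ 19" using n by (metis of_nat_le_iff of_nat_numeral of_nat_power)
  then have n0: "real n > 0" by (rule less_le_trans[rotated]) simp
  have n2: "n \<ge> 2" using n by (rule order_trans[rotated]) simp
  have a0: "a > 0" and r0: "r > 0" using n0 by (auto simp: a_def r_def)
  have fin: "finite \<Omega>" by (simp add: \<Omega>_def)
  have F\<Omega>: "F \<subseteq> Pow \<Omega>" using F by (auto simp: \<Omega>_def spanning_tree_def)
  have finF: "finite F" by (rule finite_subset[OF F\<Omega>]) (simp add: fin)
  have bound: "real (card (trees_over n X)) * r ^ card X \<le> a" if "X \<subseteq> \<Omega>" for X
    using card_trees_over_le[of X n] that n2 by (simp add: a_def r_def \<Omega>_def)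
  have R0: "real n / 4 > 0" using n0 by simp
  from spread_approximation[OF fin F\<Omega> R0, of q] obtain P F' where F': "F' \<subseteq> F"
    and P: "\<forall>(S, G)\<in>P. S \<subseteq> \<Omega> \<and> card S \<le> q \<and> G \<subseteq> F \<and> spread_over \<Omega> (real n / 4) S G"
    and cover: "\<forall>A\<in>F. A \<in> F' \<or> (\<exists>(S, G)\<in>P. A \<in> G)"
    and rest: "F' = {} \<or> (\<exists>S\<subseteq>\<Omega>. q < card S \<and> real (card F')
        \<le> (real n / 4) ^ card S * real (card {A\<in>F. S \<subseteq> A}))"
    by blast
  have finF': "finite F'" using F' finF by (rule finite_subset)
  have F'_small: "real (card F') * real n ^ (t + 7) < a"
    using rest
  proof
    assume "F' = {}"
    then show ?thesis using a0 by simp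
  next
    assume "\<exists>S\<subseteq>\<Omega>. q < card S \<and> real (card F') \<le> (real n / 4) ^ card S * real (card {A\<in>F. S \<subseteq> A})"
    then obtain S where S: "S \<subseteq> \<Omega>" "q < card S"
      "real (card F') \<le> (real n / 4) ^ card S * real (card {A\<in>F. S \<subseteq> A})" by blast
    have "card {A\<in>F. S \<subseteq> A} \<le> card (trees_over n S)"
      using F by (intro card_mono) (auto simp: trees_over_def[symmetric], auto simp: trees_over_def)
    then have "(real n / 4) ^ card S * real (card {A\<in>F. S \<subseteq> A})
        \<le> (real n / 4) ^ card S * real (card (trees_over n S))"
      by (intro mult_left_mono) auto
    \<comment> \<open>The links are asked to be half as spread as the trees are, so every element of
      S contributes a factor 1/2.\<close>
    moreover have "(real n / 4) ^ card S = (1 / 2) ^ card S * r ^ card S"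
      unfolding r_def by (simp flip: power_mult_distrib)
    ultimately have "real (card F') \<le> (1 / 2) ^ card S * (real (card (trees_over n S)) * r ^ card S)"
      using S(3) by (simp add: mult_ac)
    also have "\<dots> \<le> (1 / 2) ^ card S * a" using bound[OF S(1)] by (intro mult_left_mono) auto
    also have "\<dots> \<le> (1 / 2) ^ (q + 1) * a"
      using S(2) a0 by (intro mult_right_mono power_decreasing) auto
    finally have "real (card F') * 2 ^ (q + 1) \<le> a"
      by (simp add: power_one_over field_simps)
    show ?thesis
    proof (cases "F' = {}")
      case False
      then have "real (card F') > 0" using finF' by (simp add: card_gt_0_iff)
      then have "real (card F') * real n ^ (t + 7) < real (card F') * 2 ^ (q + 1)"
        using q(1) by (intro mult_strict_left_mono)
      then show ?thesis using \<open>real (card F') * 2 ^ (q + 1) \<le> a\<close> by simp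
    qed (use a0 in simp)
  qed
  have n7: "real (card F') * real n ^ t * real n ^ 7 < a"
    using F'_small by (simp add: power_add mult_ac)
  have n_pow: "4 \<le> real n ^ 7"
  proof -
    have "4 \<le> real n" using n19 by simp
    also have "\<dots> \<le> real n ^ 7" using n0 n2 by (intro self_le_power) auto
    finally show ?thesis .
  qed
  \<comment> \<open>Cases with room to spare use this crude share; \<open>n7\<close> keeps the full
    saving for the comparison with the trees ruled out.\<close>
  have F'_quarter: "real (card F') * real n ^ t \<le> a / 4"
  proof -
    have "real (card F') * real n ^ t * 4 \<le> real (card F') * real n ^ t * real n ^ 7"
      using n_pow by (intro mult_left_mono) auto
    then show ?thesis using n7 by simp
  qed
  have target: "a \<le> 2 ^ t * a" using a0 by simp
  define \<S> where "\<S> = fst ` P"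
  have P': "S \<subseteq> \<Omega>" "card S \<le> q" "G \<subseteq> F" "spread_over \<Omega> (real n / 4) S G" if "(S, G) \<in> P" for S G
    using bspec[OF P that] by auto
  have S\<Omega>: "\<S> \<subseteq> Pow \<Omega>" using P'(1) by (force simp: \<S>_def)
  have S_int: "intersecting_family t \<S>"
    unfolding intersecting_family_def
  proof (intro ballI)
    fix S S' assume "S \<in> \<S>" "S' \<in> \<S>"
    then obtain G G' where PG: "(S, G) \<in> P" "(S', G') \<in> P" by (auto simp: \<S>_def)
    have S: "S \<subseteq> \<Omega>" "card S \<le> q" "G \<subseteq> F" "spread_over \<Omega> (real n / 4) S G"
      and S': "S' \<subseteq> \<Omega>" "card S' \<le> q" "G' \<subseteq> F" "spread_over \<Omega> (real n / 4) S' G'"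
      using P'[OF PG(1)] P'[OF PG(2)] by auto
    have small: "8 * real (card X) \<le> real n / 4" if "card X \<le> q" for X :: "nat set set"
    proof -
      have "real (card X) \<le> real q" using that by simp
      then show ?thesis using q(2) n0 by linarith
    qed
    have cardF: "card A \<le> n" if "A \<in> F" for A
      using card_spanning_tree[of n A] F that n2 by simp
    have R: "2 ^ 17 \<le> real n / 4" "real n \<le> 4 * (real n / 4)" using n19 by auto
    obtain A B where AB: "A \<in> G" "B \<in> G'" "A \<inter> B \<subseteq> S \<inter> S'"
      by (rule spread_over_members_intersection[OF S(4,3) S'(4,3) F\<Omega> cardF
            S(1) small[OF S(2)] S'(1) small[OF S'(2)] fin R])
    have "t \<le> card (A \<inter> B)" using int AB S(3) S'(3) by (auto simp: t_intersecting_def)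
    also have "\<dots> \<le> card (S \<inter> S')"
      using AB(3) finite_subset[OF S(1) fin] by (intro card_mono) auto
    finally show "t \<le> card (S \<inter> S')" .
  qed
  have S_card: "card S \<le> t + (q - t)" if "S \<in> \<S>" for S using P'(2) that q(3) by (force simp: \<S>_def)
  have S_cover: "\<exists>S\<in>\<S>. S \<subseteq> A" if A: "A \<in> F" "A \<notin> F'" for A
  proof -
    obtain S G where SG: "(S, G) \<in> P" "A \<in> G" using cover A by blast
    then have "spread_over \<Omega> (real n / 4) S G" using P'(4) by blast
    then have "S \<subseteq> A" using SG(2) by (simp add: spread_over_def)
    then show ?thesis using SG(1) unfolding \<S>_def by force
  qed
  define \<A> where "\<A> = trees_over n {}"
  have A_over: "{A\<in>\<A>. X \<subseteq> A} = trees_over n X" for X by (auto simp: \<A>_def trees_over_def)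
  have FA: "F \<subseteq> \<A>" using F by (auto simp: \<A>_def trees_over_def)
  have finA: "finite \<A>" by (simp add: \<A>_def)
  have split: "real (card F) \<le> real (card F') + real (card (F - F'))"
    using card_Un_le[of F' "F - F'"] F' by (simp add: Un_absorb1 flip: of_nat_add)
  have rq: "24 * real q \<le> r" using q(2) n0 by (simp add: r_def)
  have "(\<exists>T. card T = t \<and> (\<forall>A\<in>\<S>. T \<subseteq> A)) \<or>
    real (card {A\<in>\<A>. \<exists>S\<in>\<S>. S \<subseteq> A}) \<le> ((1 - (1 / 2) ^ (q - t)) / 4 + real q / r) * (a / r ^ t)"
  proof (rule intersecting_family_cover[OF fin finA _ rq r0 S\<Omega> S_int S_card])
    show "real (card {A\<in>\<A>. X \<subseteq> A}) * r ^ card X \<le> a" if "X \<subseteq> \<Omega>" for X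
      unfolding A_over using bound[OF that] .
    show "t + (q - t) \<le> q" using q(3) by simp
  qed
  then show ?thesis
  proof
    assume le: "real (card {A\<in>\<A>. \<exists>S\<in>\<S>. S \<subseteq> A})
        \<le> ((1 - (1 / 2) ^ (q - t)) / 4 + real q / r) * (a / r ^ t)"
    have "F - F' \<subseteq> {A\<in>\<A>. \<exists>S\<in>\<S>. S \<subseteq> A}" using S_cover FA by blast
    then have "card (F - F') \<le> card {A\<in>\<A>. \<exists>S\<in>\<S>. S \<subseteq> A}" using finA by (intro card_mono) auto
    then have "real (card (F - F')) \<le> ((1 - (1 / 2) ^ (q - t)) / 4 + real q / r) * (a / r ^ t)"
      using le by linarith
    \<comment> \<open>The geometric sum is at most 1/4 and q / r at most 1/24. The covered part is
      thus at most half of a full star, which leaves room for \<open>F'\<close>.\<close>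
    also have "\<dots> \<le> (1 / 2) * (a / r ^ t)"
    proof (intro mult_right_mono)
      have "(1 - (1 / 2) ^ (q - t)) / 4 + real q / r \<le> 1 / 4 + 1 / 24"
        using rq r0 by (intro add_mono) (auto simp: field_simps)
      also have "\<dots> \<le> (1 / 2 :: real)" by simp
      finally show "(1 - (1 / 2) ^ (q - t)) / 4 + real q / r \<le> 1 / 2" .
    qed (use a0 r0 in auto)
    finally have "real (card (F - F')) * r ^ t \<le> a / 2" using r0 by (simp add: field_simps)
    then have "real (card (F - F')) * real n ^ t \<le> 2 ^ t * a / 2"
      by (simp add: r_def power_divide field_simps)
    then have "real (card F) * real n ^ t \<le> 2 ^ t * a / 2 + a / 4"
      using mult_right_mono[OF split, of "real n ^ t"] F'_quarter by (simp add: distrib_right)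
    also have "\<dots> < 2 ^ t * a" using target a0 by linarith
    finally show ?thesis by (simp add: a_def)
  next
    assume "\<exists>T. card T = t \<and> (\<forall>A\<in>\<S>. T \<subseteq> A)"
    then obtain T where T: "card T = t" "\<And>S. S \<in> \<S> \<Longrightarrow> T \<subseteq> S" by blast
    have F_T: "F - F' \<subseteq> trees_over n T"
      using S_cover T(2) F by (fastforce simp: trees_over_def)
    show ?thesis
    \<comment> \<open>Only a tree of F outside \<open>F'\<close> shows that T consists of edges of
      K_n, hence this distinction.\<close>
    proof (cases "F \<subseteq> F'")
      case True
      then have eq: "F = F'" using F' by blast
      have "real (card F') * real n ^ t < 2 ^ t * a" using F'_quarter target a0 by linarith
      then show ?thesis unfolding eq by (simp add: a_def)
    next
      case False
      then have "T \<subseteq> Kn_edges n" using F_T by (auto simp: trees_over_def spanning_tree_def)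
      note TK = this
      have le_T: "real (card (F - F')) \<le> real (card (trees_over n T))"
        using F_T by (simp add: card_mono)
      show ?thesis
      proof (cases "pairwise disjnt T")
        case False
        have "real (card (F - F')) * real n ^ t \<le> real (card (trees_over n T)) * real n ^ t"
          using le_T by (intro mult_right_mono) auto
        also have "\<dots> \<le> (2 ^ t - 1) * a"
          using card_trees_over_not_matching[OF TK n2 False] T(1) by (simp add: a_def)
        finally have "real (card F) * real n ^ t \<le> a / 4 + (2 ^ t - 1) * a"
          using mult_right_mono[OF split, of "real n ^ t"] F'_quarter by (simp add: distrib_right)
        also have "\<dots> < 2 ^ t * a" using a0 by (simp add: algebra_simps)
        finally show ?thesis by (simp add: a_def)
      next
        case True
        have full: "real (card (trees_over n T)) * real n ^ t = 2 ^ t * a"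
          using card_trees_over_matching[OF TK n2 True] T(1) by (simp add: a_def)
        show ?thesis
        proof (cases "F \<subseteq> trees_over n T")
          case sub: True
          show ?thesis
          proof (cases "F = trees_over n T")
            case True
            then show ?thesis using TK T(1) \<open>pairwise disjnt T\<close> by blast
          next
            case False
            then have "card F < card (trees_over n T)" using sub by (intro psubset_card_mono) auto
            then have "real (card F) * real n ^ t < real (card (trees_over n T)) * real n ^ t"
              using n0 by (intro mult_strict_right_mono) auto
            then show ?thesis using full by (simp add: a_def)
          qed
        next
          case False
          then obtain F0 where F0: "F0 \<in> F" "F0 \<notin> trees_over n T" by blast
          have F0t: "spanning_tree n F0" "\<not> T \<subseteq> F0" using F0 F by (auto simp: trees_over_def)
          \<comment> \<open>These trees contain T but cannot be in F together with
            \<open>F0\<close>.\<close>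
          define B where "B = {A\<in>trees_over n T. card (A \<inter> F0) < t}"
          have B: "real (card (trees_over n T)) \<le> 2 * real n ^ 6 * real (card B)"
            using card_few_intersections[OF F0t(1) TK True F0t(2) n2] t(1) T(1) by (simp add: B_def)
          have "F - F' \<subseteq> trees_over n T - B"
            using F_T int F0 by (fastforce simp: B_def t_intersecting_def)
          then have "card (F - F') \<le> card (trees_over n T - B)" by (intro card_mono) auto
          also have "\<dots> = card (trees_over n T) - card B"
            by (intro card_Diff_subset) (auto simp: B_def)
          also have "card B \<le> card (trees_over n T)" by (intro card_mono) (auto simp: B_def)
          ultimately have "real (card (F - F')) \<le> real (card (trees_over n T)) - real (card B)"
            by linarith
          then have "real (card F) \<le> real (card F') + real (card (trees_over n T)) - real (card B)"
            using split by linarith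
          \<comment> \<open>\<open>B\<close> holds at least a 1 / (2 n^6) share of the star, and
            \<open>F'\<close> is smaller than a 1 / n^7 share. As n >= 2, the trees ruled out
            outnumber the uncovered ones.\<close>
          moreover have "real (card F') < real (card B)"
          proof -
            have "real (card F') * real n ^ t * real n ^ 7 < 2 ^ t * a" using n7 target by linarith
            also have "\<dots> \<le> 2 * real n ^ 6 * real (card B) * real n ^ t"
              using mult_right_mono[OF B, of "real n ^ t"] full by simp
            finally have "(real (card F') * real n) * (real n ^ 6 * real n ^ t)
                < (2 * real (card B)) * (real n ^ 6 * real n ^ t)"
              by (simp add: mult_ac power_numeral_reduce)
            then have "real (card F') * real n < 2 * real (card B)"
              using n0 by (simp add: mult_less_cancel_right)
            moreover have "real (card F') * 2 \<le> real (card F') * real n"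
              using n2 by (intro mult_left_mono) auto
            ultimately show ?thesis by linarith
          qed
          ultimately have "real (card F) < real (card (trees_over n T))" by linarith
          then have "real (card F) * real n ^ t < real (card (trees_over n T)) * real n ^ t"
            using n0 by (intro mult_strict_right_mono) auto
          then show ?thesis using full by (simp add: a_def)
        qed
      qed
    qed
  qed
qed

theorem theorem1p4:
  fixes n t :: nat and F :: "nat set set set"
  assumes "n \<ge> 2 ^ 19"
    and "1 < t" and "real t \<le> real n / (4032 * log 2 (real n))"
    and "\<forall>T\<in>F. spanning_tree n T"
    and "t_intersecting t F"
  shows "real (card F) \<le> 2 ^ t * real n ^ (n - t - 2) \<and>
         (real (card F) = 2 ^ t * real n ^ (n - t - 2) \<longleftrightarrow>
           (\<exists>M. M \<subseteq> Kn_edges n \<and> card M = t \<and> pairwise disjnt M \<and>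
                F = {T. spanning_tree n T \<and> M \<subseteq> T}))"
proof -
  obtain q where q: "896 * real q \<le> real n" "t \<le> q"
    using spanning_tree_parameters[OF assms(1-3)] .
  have n2: "n \<ge> 2" using assms(1) by (rule order_trans[rotated]) simp
  have "real (896 * q) \<le> real n" using q(1) by simp
  then have "896 * q \<le> n" by (simp only: of_nat_le_iff)
  \<comment> \<open>Makes n - t - 2 a genuine difference, so that n ^ t can be split off and
    cancelled.\<close>
  then have tn: "t + 2 \<le> n" using q(2) assms(2) by linarith
  have "n - 2 = (n - t - 2) + t" using tn by simp
  then have pow: "2 ^ t * real n ^ (n - 2) = (2 ^ t * real n ^ (n - t - 2)) * real n ^ t"
    by (simp add: power_add)
  have equality: "real (card F) = 2 ^ t * real n ^ (n - t - 2)"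
    if M: "M \<subseteq> Kn_edges n" "card M = t" "pairwise disjnt M" "F = trees_over n M" for M
    using card_trees_over_matching[OF M(1) n2 M(3)] M(2,4) pow n2 by simp
  from t_intersecting_spanning_trees[OF assms]
  consider "real (card F) < 2 ^ t * real n ^ (n - t - 2)"
    | M where "M \<subseteq> Kn_edges n" "card M = t" "pairwise disjnt M" "F = trees_over n M"
    unfolding pow using n2 by (auto simp: mult_less_cancel_right)
  then show ?thesis
  proof cases
    case 1
    then have "\<nexists>M. M \<subseteq> Kn_edges n \<and> card M = t \<and> pairwise disjnt M \<and> F = trees_over n M"
      using equality by force
    then show ?thesis using 1 unfolding trees_over_def by simp
  next
    case 2
    then show ?thesis using equality[OF 2] unfolding trees_over_def by auto
  qed
qed

end
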